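(* Let $p_1\equiv p_2\equiv1\pmod4$ be primes and $\mathbb{K}=\mathbb{Q}(\sqrt2,\sqrt{p_1p_2},i)$, with maximal real subfield $\mathbb{K}^+=\mathbb{Q}(\sqrt2,\sqrt{p_1p_2})$. Let $\varepsilon_1,\varepsilon_2,\varepsilon_3$ be the fundamental units of $\mathbb{Q}(\sqrt2)$, $\mathbb{Q}(\sqrt{p_1p_2})$, $\mathbb{Q}(\sqrt{2p_1p_2})$ respectively, and write $\varepsilon_3=x+y\sqrt{2p_1p_2}$ with $x,y\in\mathbb{Z}$. Then $Q_{\mathbb{K}}=1$ and: (1) If $N(\varepsilon_2)=N(\varepsilon_3)=-1$: (i) if $\varepsilon_1\varepsilon_2\varepsilon_3$ is a square in $\mathbb{K}^+$, then $\{\varepsilon_1,\varepsilon_2,\sqrt{\varepsilon_1\varepsilon_2\varepsilon_3}\}$ is an F.S.U. of $\mathbb{K}^+$ and of $\mathbb{K}$; (ii) otherwise $\{\varepsilon_1,\varepsilon_2,\varepsilon_3\}$ is an F.S.U. of $\mathbb{K}^+$ and of $\mathbb{K}$. (2) If $N(\varepsilon_2)=1$ and $N(\varepsilon_3)=-1$: $\{\varepsilon_1,\varepsilon_2,\varepsilon_3\}$ is an F.S.U. of $\mathbb{K}^+$ and of $\mathbb{K}$. (3) If $N(\varepsilon_3)=1$ and $N(\varepsilon_2)=-1$: (i) if $x+1$ or $x-1$ is a perfect square in $\mathbb{N}$, then $\{\varepsilon_1,\varepsilon_2,\sqrt{\varepsilon_3}\}$ is an F.S.U. of $\mathbb{K}^+$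 and of $\mathbb{K}$; (ii) otherwise $\{\varepsilon_1,\varepsilon_2,\varepsilon_3\}$ is an F.S.U. of $\mathbb{K}^+$ and of $\mathbb{K}$. (4) If $N(\varepsilon_2)=N(\varepsilon_3)=1$: (i) if $x+1$ or $x-1$ is a perfect square in $\mathbb{N}$, then $\{\varepsilon_1,\varepsilon_2,\sqrt{\varepsilon_3}\}$ is an F.S.U. of $\mathbb{K}^+$ and of $\mathbb{K}$; (ii) otherwise $\{\varepsilon_1,\varepsilon_2,\sqrt{\varepsilon_2\varepsilon_3}\}$ is an F.S.U. of $\mathbb{K}^+$ and of $\mathbb{K}$.
   Context: $i=\sqrt{-1}$; $N(\cdot)$ is the norm from the relevant real quadratic field to $\mathbb{Q}$. An F.S.U. (fundamental system of units) of a number field $L$ is a set of units whose images form a basis of the free abelian group $E_L/W_L$, where $E_L$ is the unit group of $\mathcal{O}_L$ and $W_L$ the group of roots of unity in $L$. For a CM-field $L$ with maximal real subfield $L^+$, Hasse's unit index is $Q_L=[E_L:W_LE_{L^+}]$. *)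

theory Defs
  imports "HOL-Analysis.Analysis" "HOL-Computational_Algebra.Polynomial"
begin

definition alg_int :: "complex \<Rightarrow> bool" where
  "alg_int z \<longleftrightarrow> (\<exists>p :: int poly. lead_coeff p = 1 \<and> poly (map_poly of_int p) z = 0)"

definition units_of_field :: "complex set \<Rightarrow> complex set" where
  "units_of_field F = {z \<in> F. z \<noteq> 0 \<and> alg_int z \<and> alg_int (inverse z)}"

definition roots_of_unity_in :: "complex set \<Rightarrow> complex set" where
  "roots_of_unity_in F = {z \<in> F. \<exists>n::nat. n > 0 \<and> z ^ n = 1}"

(* F.S.U.: units whose images form a basis of E_F / W_F *)
definition is_FSU :: "complex set \<Rightarrow> complex list \<Rightarrow> bool" where
  "is_FSU F us \<longleftrightarrow> set us \<subseteq> units_of_field F \<and>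
     (\<forall>e \<in> units_of_field F. \<exists>!ks :: int list. length ks = length us \<and>
        e * inverse (prod_list (map2 (\<lambda>u k. u powi k) us ks)) \<in> roots_of_unity_in F)"

definition hasse_unit_index :: "complex set \<Rightarrow> complex set \<Rightarrow> nat" where
  "hasse_unit_index L Lplus =
     (let H = {w * u | w u. w \<in> roots_of_unity_in L \<and> u \<in> units_of_field Lplus}
      in card ((\<lambda>x. (\<lambda>h. x * h) ` H) ` units_of_field L))"

definition quad_field :: "real \<Rightarrow> complex set" where
  "quad_field m = {complex_of_real (of_rat a + of_rat b * sqrt m) | a b. True}"

definition biquad_field :: "real \<Rightarrow> complex set" where
  "biquad_field d = {complex_of_real (of_rat a + of_rat b * sqrt 2 + of_rat c * sqrt d
                       + of_rat e * sqrt (2 * d)) | a b c e. True}"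

definition K_field :: "real \<Rightarrow> complex set" where
  "K_field d = {u + \<i> * v | u v. u \<in> biquad_field d \<and> v \<in> biquad_field d}"

definition fundamental_unit :: "real \<Rightarrow> real \<Rightarrow> bool" where
  "fundamental_unit m \<epsilon> \<longleftrightarrow> complex_of_real \<epsilon> \<in> units_of_field (quad_field m) \<and> \<epsilon> > 1 \<and>
     (\<forall>u \<in> units_of_field (quad_field m). \<exists>n::int.
        u = complex_of_real \<epsilon> powi n \<or> u = - (complex_of_real \<epsilon> powi n))"

definition qnorm :: "real \<Rightarrow> real \<Rightarrow> real" where
  "qnorm m z = (THE n. \<exists>a b :: rat. z = of_rat a + of_rat b * sqrt m \<and> n = of_rat a ^ 2 - m * of_rat b ^ 2)"

definition is_nat_square :: "int \<Rightarrow> bool" where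
  "is_nat_square z \<longleftrightarrow> (\<exists>n::nat. z = int n ^ 2)"

end

theory Submission
  imports Defs "HOL-Computational_Algebra.Squarefree" "Jordan_Normal_Form.Char_Poly"
begin

text \<open>
  Write \<open>d = p1 * p2\<close>. For a unit \<open>\<eta>\<close> of the real biquadratic field, Kubota's identity
  \<open>\<eta>\<^sup>2 = N1(\<eta>) * N2(\<eta>) / N3(\<tau> \<eta>)\<close> with the norms to the three quadratic subfields expresses
  \<open>\<eta>\<^sup>2\<close> as \<open>\<plusminus>\<epsilon>1^a * \<epsilon>2^b * \<epsilon>3^c\<close>, so a fundamental system is found by deciding which of these
  products are squares. Taking norms settles the parities of the exponents up to the question
  whether units of norm 1 are squares. A unit \<open>\<epsilon>\<close> of norm 1 and trace \<open>t\<close> satisfies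
  \<open>\<epsilon> * (t + 2) = (1 + \<epsilon>)\<^sup>2\<close>, and a rational number is a square in the biquadratic field iff it
  lies in one of the classes 1, 2, \<open>d\<close>, \<open>2 * d\<close> modulo rational squares.

  For the index, let \<open>\<eta>\<close> be a unit of the imaginary field. The trace of \<open>w = \<eta> / cnj \<eta>\<close> is an algebraic
  integer all of whose conjugates lie in \<open>[-2, 2]\<close>; as \<open>d > 64\<close> it is one of \<open>0, \<plusminus>1, \<plusminus>2, \<plusminus>sqrt 2\<close>.
  The last value would make \<open>2 \<plusminus> sqrt 2\<close> a square up to a unit, which norms to
  \<open>\<rat>(sqrt d)\<close> forbid; otherwise \<open>w\<close> is the square of a root of unity \<open>\<zeta>\<close> of the field, and
  \<open>\<eta> / \<zeta>\<close> is real.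
\<close>

section \<open>Algebraic integers form a ring\<close>

definition int_span :: "complex set \<Rightarrow> complex set" where
  "int_span S = {\<Sum>s\<in>S. of_int (c s) * s | c. True}"

lemma int_span_sup:
  assumes "finite S" "s \<in> S"
  shows "s \<in> int_span S"
proof -
  have "(\<Sum>t\<in>S. of_int (if t = s then 1 else 0) * t) = (\<Sum>t\<in>S. if t = s then s else 0)"
    by (rule sum.cong) auto
  then show ?thesis using assms unfolding int_span_def
    by (intro CollectI exI[of _ "\<lambda>t. if t = s then 1 else 0"]) simp
qed

lemma int_span_add: "u \<in> int_span S \<Longrightarrow> v \<in> int_span S \<Longrightarrow> u + v \<in> int_span S"
  unfolding int_span_def
proof (clarify, goal_cases)
  case (1 c d)
  show ?case by (rule exI[of _ "\<lambda>s. c s + d s"]) (simp add: sum.distrib ring_distribs)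
qed

lemma int_span_scale: "u \<in> int_span S \<Longrightarrow> of_int k * u \<in> int_span S"
  unfolding int_span_def
proof (clarify, goal_cases)
  case (1 c)
  show ?case by (rule exI[of _ "\<lambda>s. k * c s"]) (simp add: sum_distrib_left mult.assoc)
qed

lemma int_span_0: "0 \<in> int_span S"
  unfolding int_span_def by (rule CollectI, rule exI[of _ "\<lambda>_. 0"]) simp

lemma int_span_sum: "(\<And>i. i \<in> I \<Longrightarrow> f i \<in> int_span S) \<Longrightarrow> sum f I \<in> int_span S"
  by (induction I rule: infinite_finite_induct) (auto simp: int_span_0 int_span_add)

lemma int_span_mult_closed:
  assumes "\<And>s. s \<in> S \<Longrightarrow> x * s \<in> int_span S" "u \<in> int_span S"
  shows "x * u \<in> int_span S"
proof -
  from assms(2) obtain c where u: "u = (\<Sum>s\<in>S. of_int (c s) * s)"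
    unfolding int_span_def by blast
  have "x * u = (\<Sum>s\<in>S. of_int (c s) * (x * s))"
    unfolding u by (simp add: sum_distrib_left mult_ac)
  then show ?thesis by (simp add: int_span_sum int_span_scale assms(1))
qed

text \<open>The determinant trick: multiplication by \<open>x\<close> acts on the generators through
  an integer matrix. The vector of generators is an eigenvector for \<open>x\<close>, nonzero
  because of \<open>t\<close>, so \<open>x\<close> is a root of a monic integral characteristic
  polynomial.\<close>

lemma alg_int_if_stabilizes_span:
  assumes fin: "finite S" and ne: "t \<in> S" "t \<noteq> 0"
    and st: "\<And>s. s \<in> S \<Longrightarrow> x * s \<in> int_span S"
  shows "alg_int x"
proof -
  define n where "n = card S"
  obtain f where f: "bij_betw f {..<n} S"
    using ex_bij_betw_nat_finite[OF fin] unfolding n_def lessThan_atLeast0 by blast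
  have "\<forall>s\<in>S. \<exists>c. x * s = (\<Sum>t\<in>S. of_int (c t) * t)"
    using st unfolding int_span_def by blast
  then obtain C where C: "\<And>s. s \<in> S \<Longrightarrow> x * s = (\<Sum>t\<in>S. of_int (C s t) * t)"
    by metis
  define M :: "int mat" where "M = mat n n (\<lambda>(i,j). C (f i) (f j))"
  define N :: "complex mat" where "N = map_mat of_int M"
  define V where "V = vec n f"
  have M: "M \<in> carrier_mat n n" and N: "N \<in> carrier_mat n n"
    by (auto simp: M_def N_def)
  obtain k where k: "k < n" "f k = t" using f ne(1) unfolding bij_betw_def by blast
  have "V \<noteq> 0\<^sub>v n"
    using k ne(2) by (auto simp: V_def dest!: arg_cong[where f = "\<lambda>v. vec_index v k"])
  moreover have "N *\<^sub>v V = x \<cdot>\<^sub>v V"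
  proof (rule eq_vecI)
    fix i assume "i < dim_vec (x \<cdot>\<^sub>v V)"
    then have i: "i < n" by (simp add: V_def)
    have "vec_index (N *\<^sub>v V) i = (\<Sum>j<n. of_int (C (f i) (f j)) * f j)"
      using i by (simp add: N_def M_def V_def scalar_prod_def lessThan_atLeast0)
    also have "\<dots> = (\<Sum>t\<in>S. of_int (C (f i) t) * t)"
      by (rule sum.reindex_bij_betw[OF f])
    also have "\<dots> = x * f i" using C[of "f i"] f i unfolding bij_betw_def by auto
    finally show "vec_index (N *\<^sub>v V) i = vec_index (x \<cdot>\<^sub>v V) i"
      using i by (simp add: V_def)
  qed (use N in \<open>simp add: V_def\<close>)
  ultimately have "eigenvalue N x"
    unfolding eigenvalue_def eigenvector_def using N by (intro exI[of _ V]) (auto simp: V_def)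
  then have "poly (char_poly N) x = 0" using eigenvalue_root_char_poly[OF N] by simp
  moreover have "char_poly N = map_poly of_int (char_poly M)"
    unfolding N_def by (rule of_int_hom.char_poly_hom[OF M])
  moreover have "lead_coeff (char_poly M) = 1"
    using degree_monic_char_poly[OF M] by simp
  ultimately show ?thesis unfolding alg_int_def by metis
qed

lemma alg_int_power_reduce:
  assumes "alg_int a"
  obtains n c where "n > 0" "a ^ n = (\<Sum>i<n. of_int (c i) * a ^ i)"
proof -
  from assms obtain p :: "int poly" where p: "lead_coeff p = 1" "poly (map_poly of_int p) a = 0"
    unfolding alg_int_def by blast
  define n where "n = degree p"
  have "degree (map_poly of_int p :: complex poly) = n"
    unfolding n_def by (rule degree_map_poly) auto
  then have "0 = (\<Sum>i\<le>n. of_int (coeff p i) * a ^ i)"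
    using p(2) by (simp add: poly_altdef coeff_map_poly)
  also have "\<dots> = a ^ n + (\<Sum>i<n. of_int (coeff p i) * a ^ i)"
    using p(1) by (simp add: n_def flip: lessThan_Suc_atMost)
  finally have eq: "a ^ n = (\<Sum>i<n. of_int (- coeff p i) * a ^ i)"
    by (simp add: sum_negf eq_neg_iff_add_eq_0)
  \<comment> \<open>A monic constant is 1 and has no root.\<close>
  then have "n > 0" by (cases "n = 0") auto
  from that[OF this eq] show ?thesis .
qed

text \<open>The products \<open>a ^ i * b ^ j\<close> with exponents below the two degrees span a
  module stable under \<open>a\<close> and \<open>b\<close>: when an exponent reaches the degree,
  the monic equation lowers it. The module is then stable under \<open>a + b\<close> and
  \<open>a * b\<close> as well.\<close>

lemma
  assumes "alg_int a" "alg_int b"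
  shows alg_int_add: "alg_int (a + b)" and alg_int_mult: "alg_int (a * b)"
proof -
  obtain n c where n: "n > 0" "a ^ n = (\<Sum>i<n. of_int (c i) * a ^ i)"
    using alg_int_power_reduce[OF assms(1)] by blast
  obtain m d where m: "m > 0" "b ^ m = (\<Sum>i<m. of_int (d i) * b ^ i)"
    using alg_int_power_reduce[OF assms(2)] by blast
  define S where "S = (\<lambda>(i,j). a ^ i * b ^ j) ` ({..<n} \<times> {..<m})"
  have fin: "finite S" by (simp add: S_def)
  have mem: "a ^ i * b ^ j \<in> int_span S" if "i < n" "j < m" for i j
    using that by (intro int_span_sup[OF fin]) (auto simp: S_def)
  have a: "a * s \<in> int_span S" if "s \<in> S" for s
  proof -
    from that obtain i j where ij: "s = a ^ i * b ^ j" "i < n" "j < m" by (auto simp: S_def)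
    show ?thesis
    proof (cases "Suc i < n")
      case True
      then show ?thesis using mem[of "Suc i" j] ij by (simp add: mult.assoc)
    next
      case False
      then have "Suc i = n" using ij by simp
      then have "a * s = a ^ n * b ^ j" using ij by auto
      also have "\<dots> = (\<Sum>k<n. of_int (c k) * (a ^ k * b ^ j))"
        by (simp add: n(2) sum_distrib_right mult.assoc)
      finally show ?thesis using mem ij by (auto intro!: int_span_sum int_span_scale)
    qed
  qed
  have b: "b * s \<in> int_span S" if "s \<in> S" for s
  proof -
    from that obtain i j where ij: "s = a ^ i * b ^ j" "i < n" "j < m" by (auto simp: S_def)
    show ?thesis
    proof (cases "Suc j < m")
      case True
      then show ?thesis using mem[of i "Suc j"] ij by (simp add: mult_ac)
    next
      case False
      then have "Suc j = m" using ij by simp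
      then have "b * s = a ^ i * b ^ m" using ij by auto
      also have "\<dots> = (\<Sum>k<m. of_int (d k) * (a ^ i * b ^ k))"
        by (simp add: m(2) sum_distrib_left mult_ac)
      finally show ?thesis using mem ij by (auto intro!: int_span_sum int_span_scale)
    qed
  qed
  have one: "1 \<in> S" using n(1) m(1) by (force simp: S_def)
  show "alg_int (a + b)" using a b
    by (intro alg_int_if_stabilizes_span[OF fin one]) (auto simp: ring_distribs int_span_add)
  show "alg_int (a * b)" using int_span_mult_closed[OF a b]
    by (intro alg_int_if_stabilizes_span[OF fin one]) (auto simp: mult.assoc)
qed

lemma alg_int_iff_algebraic_int: "alg_int z \<longleftrightarrow> algebraic_int z"
  unfolding alg_int_def algebraic_int_altdef_ipoly by (auto simp: conj_commute)

lemma
  assumes "algebraic_int a" "algebraic_int b"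
  shows algebraic_int_add_complex: "algebraic_int (a + b :: complex)"
    and algebraic_int_mult_complex: "algebraic_int (a * b :: complex)"
  using alg_int_add alg_int_mult assms unfolding alg_int_iff_algebraic_int by blast+

lemma
  assumes "algebraic_int a" "algebraic_int b"
  shows algebraic_int_add_real: "algebraic_int (a + b :: real)"
    and algebraic_int_mult_real: "algebraic_int (a * b :: real)"
  using algebraic_int_add_complex[of "of_real a" "of_real b"]
    algebraic_int_mult_complex[of "of_real a" "of_real b"] assms
  by (simp_all flip: of_real_add of_real_mult)

section \<open>Quadratic extensions of real fields\<close>

definition real_subfield :: "real set \<Rightarrow> bool" where
  "real_subfield F \<longleftrightarrow> 1 \<in> F \<and> (\<forall>x\<in>F. \<forall>y\<in>F. x - y \<in> F \<and> x * y \<in> F \<and> inverse x \<in> F)"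

definition adjoin :: "real set \<Rightarrow> real \<Rightarrow> real set" where
  "adjoin F s = {u + v * s | u v. u \<in> F \<and> v \<in> F}"

text \<open>The description is determined only if coordinates over \<open>F\<close> are unique, that
  is for \<open>s\<close> outside \<open>F\<close>; the locale \<open>quad_ext\<close> supplies
  this.\<close>

definition quad_conj :: "real set \<Rightarrow> real \<Rightarrow> real \<Rightarrow> real" where
  "quad_conj F s z = (THE w. \<exists>u\<in>F. \<exists>v\<in>F. z = u + v * s \<and> w = u - v * s)"

definition real_units :: "real set \<Rightarrow> real set" where
  "real_units F = {x \<in> F. x \<noteq> 0 \<and> algebraic_int x \<and> algebraic_int (inverse x)}"

lemma units_of_field_real: "units_of_field (complex_of_real ` F) = complex_of_real ` real_units F"
  unfolding units_of_field_def real_units_def alg_int_iff_algebraic_int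
  by (auto simp flip: of_real_inverse)

lemma real_subfield_Rats: "real_subfield \<rat>"
  by (auto simp: real_subfield_def)

section \<open>Closure rules for real subfields and their unit groups\<close>

context
  fixes F assumes F: "real_subfield F"
begin

lemma subfield_1: "1 \<in> F" using F by (auto simp: real_subfield_def)
lemma subfield_diff: "x \<in> F \<Longrightarrow> y \<in> F \<Longrightarrow> x - y \<in> F" using F by (auto simp: real_subfield_def)
lemma subfield_mult: "x \<in> F \<Longrightarrow> y \<in> F \<Longrightarrow> x * y \<in> F" using F by (auto simp: real_subfield_def)
lemma subfield_inverse: "x \<in> F \<Longrightarrow> inverse x \<in> F" using F by (auto simp: real_subfield_def)
lemma subfield_0: "0 \<in> F" using subfield_diff[OF subfield_1 subfield_1] by simp
lemma subfield_uminus: "x \<in> F \<Longrightarrow> - x \<in> F" using subfield_diff[OF subfield_0, of x] by simp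
lemma subfield_add: "x \<in> F \<Longrightarrow> y \<in> F \<Longrightarrow> x + y \<in> F"
  using subfield_diff[OF _ subfield_uminus, of x y] by simp
lemma subfield_divide: "x \<in> F \<Longrightarrow> y \<in> F \<Longrightarrow> x / y \<in> F"
  by (simp add: divide_inverse subfield_mult subfield_inverse)
lemma subfield_power: "x \<in> F \<Longrightarrow> x ^ n \<in> F"
  by (induction n) (auto simp: subfield_1 subfield_mult)
lemma subfield_powi: "x \<in> F \<Longrightarrow> x powi n \<in> F"
  by (auto simp: power_int_def subfield_power subfield_inverse)
lemma subfield_of_nat: "of_nat n \<in> F"
  by (induction n) (auto simp: subfield_0 subfield_1 subfield_add)
lemma subfield_of_int: "of_int n \<in> F"
  using subfield_of_nat subfield_uminus by (cases n) (auto simp del: of_nat_Suc)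
lemma subfield_numeral: "numeral n \<in> F"
  using subfield_of_nat[of "numeral n"] by simp

lemmas subfield_intros = subfield_0 subfield_1 subfield_add subfield_diff subfield_mult
  subfield_uminus subfield_inverse subfield_divide subfield_power subfield_powi
  subfield_numeral

lemma real_units_1: "1 \<in> real_units F"
  by (auto simp: real_units_def subfield_1)

lemma real_units_mult: "x \<in> real_units F \<Longrightarrow> y \<in> real_units F \<Longrightarrow> x * y \<in> real_units F"
  by (auto simp: real_units_def subfield_mult algebraic_int_mult_real)

lemma real_units_inverse: "x \<in> real_units F \<Longrightarrow> inverse x \<in> real_units F"
  by (auto simp: real_units_def subfield_inverse)

lemma real_units_power: "x \<in> real_units F \<Longrightarrow> x ^ n \<in> real_units F"
  by (induction n) (auto simp: real_units_1 real_units_mult)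

lemma real_units_powi: "x \<in> real_units F \<Longrightarrow> x powi n \<in> real_units F"
  by (auto simp: power_int_def real_units_power real_units_inverse)

text \<open>Square roots preserve integrality, here for \<open>x\<close> and for its inverse;
  membership in \<open>F\<close> has to be given.\<close>

lemma real_units_root:
  assumes "x ^ 2 \<in> real_units F" "x \<in> F"
  shows "x \<in> real_units F"
proof -
  have "algebraic_int (x ^ 2)" "algebraic_int ((inverse x) ^ 2)" "x \<noteq> 0"
    using assms(1) by (auto simp: real_units_def power_inverse)
  moreover have "algebraic_int y" if "algebraic_int (y ^ 2)" for y :: real
    using algebraic_int_sqrt[OF that] by simp
  ultimately show ?thesis using assms(2) by (auto simp: real_units_def)
qed

end

section \<open>Conjugation and relative norm of a quadratic extension\<close>

locale quad_ext =
  fixes F :: "real set" and s :: real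
  assumes F: "real_subfield F" and s2: "s * s \<in> F" and s: "s \<notin> F"
begin

abbreviation "E \<equiv> adjoin F s"
abbreviation "cj \<equiv> quad_conj F s"

lemmas F_intros = subfield_intros[OF F]

lemma coord_unique:
  assumes "u + v * s = u' + v' * s" "u \<in> F" "v \<in> F" "u' \<in> F" "v' \<in> F"
  shows "u = u' \<and> v = v'"
proof -
  have "v = v'"
  proof (rule ccontr)
    assume "v \<noteq> v'"
    with assms(1) have "s = (u' - u) / (v - v')" by (simp add: field_simps)
    with assms s show False by (metis F_intros(4,8))
  qed
  with assms(1) show ?thesis by simp
qed

lemma cj_eq: "u \<in> F \<Longrightarrow> v \<in> F \<Longrightarrow> cj (u + v * s) = u - v * s"
  unfolding quad_conj_def by (rule the_equality) (auto dest: coord_unique)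

lemma mem_EI: "u \<in> F \<Longrightarrow> v \<in> F \<Longrightarrow> u + v * s \<in> E"
  by (auto simp: adjoin_def)

lemma mem_EE:
  assumes "z \<in> E"
  obtains u v where "u \<in> F" "v \<in> F" "z = u + v * s"
  using assms by (auto simp: adjoin_def)

lemma base_in_E: "u \<in> F \<Longrightarrow> u \<in> E"
  using mem_EI[of u 0] by (simp add: F_intros)

lemma s_in_E: "s \<in> E"
  using mem_EI[of 0 1] by (simp add: F_intros)

lemma cj_base: "u \<in> F \<Longrightarrow> cj u = u"
  using cj_eq[of u 0] by (simp add: F_intros)

lemma cj_in_E: "z \<in> E \<Longrightarrow> cj z \<in> E"
  using mem_EI[of _ "- _"] by (elim mem_EE) (auto simp: cj_eq F_intros)

lemma cj_cj: "z \<in> E \<Longrightarrow> cj (cj z) = z"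
proof (elim mem_EE)
  fix u v assume uv: "u \<in> F" "v \<in> F" "z = u + v * s"
  then show ?thesis using cj_eq[of u "- v"] cj_eq[of u v] F_intros(6)[of v] by simp
qed

lemma s_nz: "s \<noteq> 0" using s F_intros(1) by blast

lemma mult_coord: "(u + v * s) * (u' + v' * s) = (u * u' + v * v' * (s * s)) + (u * v' + v * u') * s"
  by (simp add: algebra_simps)

lemma mult_coord': "(u - v * s) * (u' - v' * s) = (u * u' + v * v' * (s * s)) - (u * v' + v * u') * s"
  by (simp add: algebra_simps)

lemma
  assumes "x \<in> E" "y \<in> E"
  shows cj_mult: "cj (x * y) = cj x * cj y" and mult_in_E: "x * y \<in> E"
proof -
  obtain u v where uv: "u \<in> F" "v \<in> F" "x = u + v * s" using assms(1) by (rule mem_EE)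
  obtain u' v' where uv': "u' \<in> F" "v' \<in> F" "y = u' + v' * s" using assms(2) by (rule mem_EE)
  have *: "u * u' + v * v' * (s * s) \<in> F" "u * v' + v * u' \<in> F"
    using uv uv' s2 by (simp_all add: F_intros)
  show "x * y \<in> E" unfolding uv uv' mult_coord by (intro mem_EI *)
  show "cj (x * y) = cj x * cj y"
    using uv uv' by (simp only: mult_coord cj_eq[OF *] cj_eq mult_coord')
qed

lemma
  assumes "x \<in> E" "y \<in> E"
  shows cj_diff: "cj (x - y) = cj x - cj y" and diff_in_E: "x - y \<in> E"
proof -
  obtain u v where uv: "u \<in> F" "v \<in> F" "x = u + v * s" using assms(1) by (rule mem_EE)
  obtain u' v' where uv': "u' \<in> F" "v' \<in> F" "y = u' + v' * s" using assms(2) by (rule mem_EE)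
  have *: "u - u' \<in> F" "v - v' \<in> F" using uv uv' by (simp_all add: F_intros)
  have eq: "x - y = (u - u') + (v - v') * s" by (simp add: uv uv' algebra_simps)
  show "x - y \<in> E" unfolding eq by (intro mem_EI *)
  show "cj (x - y) = cj x - cj y"
    unfolding eq unfolding cj_eq[OF *] unfolding uv(3) uv'(3) cj_eq[OF uv(1,2)] cj_eq[OF uv'(1,2)]
    by (simp add: algebra_simps)
qed

lemma cj_zero_iff: "z \<in> E \<Longrightarrow> cj z = 0 \<longleftrightarrow> z = 0"
  by (metis cj_cj cj_base F_intros(1))

definition nrm :: "real \<Rightarrow> real" where "nrm z = z * cj z"

lemma nrm_in_F: "z \<in> E \<Longrightarrow> nrm z \<in> F"
proof (elim mem_EE)
  fix u v assume uv: "u \<in> F" "v \<in> F" "z = u + v * s"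
  have "nrm z = (u + v * s) * (u - v * s)" by (simp only: nrm_def uv cj_eq)
  also have "\<dots> = u * u - v * v * (s * s)" by (simp add: algebra_simps)
  finally show ?thesis using uv s2 by (simp only: F_intros)
qed

lemma trace_in_F: "z \<in> E \<Longrightarrow> z + cj z \<in> F"
  by (elim mem_EE) (simp add: cj_eq F_intros)

lemma nrm_zero_iff: "z \<in> E \<Longrightarrow> nrm z = 0 \<longleftrightarrow> z = 0"
  by (auto simp: nrm_def cj_zero_iff)

lemma inverse_in_E: assumes "z \<in> E" shows "inverse z \<in> E"
proof (cases "z = 0")
  case False
  then have "inverse z = inverse (nrm z) * cj z"
    using nrm_zero_iff[OF assms] by (simp add: nrm_def field_simps)
  then show ?thesis using assms by (simp add: nrm_in_F cj_in_E mult_in_E base_in_E F_intros)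
qed (simp add: base_in_E F_intros)

lemma subfield_E: "real_subfield E"
  unfolding real_subfield_def using base_in_E[OF F_intros(2)] diff_in_E mult_in_E inverse_in_E by blast

lemmas E_intros = subfield_intros[OF subfield_E]

lemma cj_add: "x \<in> E \<Longrightarrow> y \<in> E \<Longrightarrow> cj (x + y) = cj x + cj y"
  using cj_diff[of x "- y"] cj_diff[of 0 y] cj_base[of 0] by (simp add: E_intros F_intros)

lemma cj_inverse: "x \<in> E \<Longrightarrow> cj (inverse x) = inverse (cj x)"
  using cj_mult[of x "inverse x"] cj_base[of 0] cj_base[of 1] cj_zero_iff[of x]
  by (cases "x = 0") (simp_all add: F_intros inverse_in_E inverse_unique)

lemma cj_power: "x \<in> E \<Longrightarrow> cj (x ^ n) = cj x ^ n"
  by (induction n) (auto simp: cj_base F_intros cj_mult E_intros)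

lemma cj_powi: "x \<in> E \<Longrightarrow> cj (x powi n) = cj x powi n"
  by (auto simp: power_int_def cj_power cj_inverse E_intros)

lemma nrm_mult: "x \<in> E \<Longrightarrow> y \<in> E \<Longrightarrow> nrm (x * y) = nrm x * nrm y"
  by (simp add: nrm_def cj_mult)

lemma nrm_powi: "x \<in> E \<Longrightarrow> nrm (x powi n) = nrm x powi n"
  by (simp add: nrm_def cj_powi power_int_mult_distrib)

lemma nrm_power: "x \<in> E \<Longrightarrow> nrm (x ^ n) = nrm x ^ n"
  by (simp add: nrm_def cj_power power_mult_distrib)

lemma nrm_base: "x \<in> F \<Longrightarrow> nrm x = x ^ 2"
  by (simp add: nrm_def cj_base power2_eq_square)

lemma cj_fixed_imp_base: "z \<in> E \<Longrightarrow> cj z = z \<Longrightarrow> z \<in> F"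
  using s_nz by (elim mem_EE) (auto simp: cj_eq)

lemma cj_neg_imp: "z \<in> E \<Longrightarrow> cj z = - z \<Longrightarrow> \<exists>v\<in>F. z = v * s"
  by (elim mem_EE) (auto simp: cj_eq)

text \<open>Conjugation fixes the square of \<open>z\<close>, so it fixes or negates
  \<open>z\<close> itself.\<close>

lemma square_in_base:
  assumes "z \<in> E" "z ^ 2 \<in> F"
  shows "z \<in> F \<or> (\<exists>v\<in>F. z = v * s)"
proof -
  have "cj z ^ 2 = z ^ 2" using assms by (metis cj_power cj_base)
  then have "cj z = z \<or> cj z = - z" by (simp add: power2_eq_iff)
  then show ?thesis using assms cj_fixed_imp_base cj_neg_imp by blast
qed

text \<open>Conjugation is a ring homomorphism fixing the integers, so it commutes with integer
  polynomials. Membership in \<open>E\<close> is carried through the induction because the rules for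
  \<open>cj\<close> hold only there.\<close>

lemma cj_poly:
  assumes "z \<in> E"
  shows "poly (map_poly of_int p) (cj z) = cj (poly (map_poly of_int p) z)
    \<and> poly (map_poly of_int p) z \<in> E"
proof (induction p)
  case (pCons a p)
  have "map_poly of_int (pCons a p) = pCons (of_int a :: real) (map_poly of_int p)"
    by (rule of_int_hom.map_poly_pCons_hom)
  moreover have "real_of_int a \<in> F" by (rule subfield_of_int[OF F])
  ultimately show ?case using pCons(2) assms
    by (auto simp: cj_add cj_mult cj_base E_intros base_in_E)
qed (auto simp: cj_base F_intros E_intros)

lemma algebraic_int_cj:
  assumes "algebraic_int z" "z \<in> E" shows "algebraic_int (cj z)"
proof -
  obtain p :: "int poly" where "poly (map_poly of_int p) z = 0" "lead_coeff p = 1"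
    using assms(1) unfolding algebraic_int_altdef_ipoly by blast
  then show ?thesis using cj_poly[OF assms(2), of p] cj_base[OF F_intros(1)]
    unfolding algebraic_int_altdef_ipoly by auto
qed

lemma cj_units: "z \<in> real_units E \<Longrightarrow> cj z \<in> real_units E"
  by (auto simp: real_units_def cj_in_E cj_zero_iff algebraic_int_cj E_intros simp flip: cj_inverse)

lemma nrm_units:
  assumes "z \<in> real_units E" shows "nrm z \<in> real_units F"
proof -
  have "nrm z \<in> real_units E" using assms unfolding nrm_def
    by (intro real_units_mult[OF subfield_E] cj_units)
  moreover have "nrm z \<in> F" using assms by (intro nrm_in_F) (auto simp: real_units_def)
  ultimately show ?thesis by (auto simp: real_units_def)
qed

end

lemma real_units_Rats: "real_units \<rat> = {1, -1}"
proof -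
  have "x = 1 \<or> x = -1" if "x \<in> real_units \<rat>" for x
  proof -
    have x: "x \<in> \<int>" "inverse x \<in> \<int>" "x \<noteq> 0"
      using that by (auto simp: real_units_def intro: rational_algebraic_int_is_int)
    then obtain a b where ab: "x = of_int a" "inverse x = of_int b" by (auto elim!: Ints_cases)
    then have "real_of_int (a * b) = 1" using x(3) by (metis of_int_mult right_inverse)
    then have "a * b = 1" by linarith
    then show ?thesis using ab zmult_eq_1_iff by auto
  qed
  then show ?thesis by (auto simp: real_units_def)
qed

section \<open>Squares modulo squarefree integers\<close>

text \<open>If \<open>b\<close> is the denominator of \<open>x\<close> in lowest terms, then
  \<open>b ^ 2\<close> divides \<open>n\<close>, so \<open>b = 1\<close>. The case
  \<open>n = 1\<close> covers rationals with integral square.\<close>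

lemma rational_Ints_if_squarefree_mult_square:
  fixes n :: nat
  assumes "squarefree n" "x \<in> \<rat>" "real n * x ^ 2 \<in> \<int>"
  shows "x \<in> \<int>"
proof -
  obtain a b :: int where ab: "b > 0" "coprime a b" "x = of_int a / of_int b"
    using assms(2) by (auto elim: Rats_cases')
  obtain k where k: "real n * x ^ 2 = of_int k" using assms(3) by (auto elim: Ints_cases)
  have "real_of_int (int n * a ^ 2) = of_int (k * b ^ 2)"
    using k ab(1,3) by (simp add: field_simps)
  then have "int n * a ^ 2 = k * b ^ 2" by linarith
  then have "b ^ 2 dvd int n * a ^ 2" by simp
  moreover have "coprime (b ^ 2) (a ^ 2)" using ab(2) by (simp add: coprime_commute)
  ultimately have "b ^ 2 dvd int n" using coprime_dvd_mult_left_iff by blast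
  then have "nat b ^ 2 dvd n"
    by (metis ab(1) int_dvd_int_iff nat_0_le of_nat_power order_less_imp_le)
  then have "nat b = 1" using assms(1) by (auto simp: squarefree_def)
  then have "b = 1" by simp
  then show ?thesis using ab(3) by simp
qed

lemma sqrt_squarefree_irrational:
  fixes n :: nat
  assumes "squarefree n" "n \<noteq> 1"
  shows "sqrt (real n) \<notin> \<rat>"
proof
  assume "sqrt (real n) \<in> \<rat>"
  then have "sqrt (real n) \<in> \<int>"
    using rational_Ints_if_squarefree_mult_square[of 1 "sqrt (real n)"] by simp
  then obtain a where a: "sqrt (real n) = of_int a" by (auto elim: Ints_cases)
  then have "real n = (of_int a)\<^sup>2" by (metis of_nat_0_le_iff real_sqrt_pow2)
  also have "\<dots> = real ((nat \<bar>a\<bar>) ^ 2)" by simp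
  finally have "n = nat \<bar>a\<bar> ^ 2" by linarith
  then have "nat \<bar>a\<bar> dvd 1" using assms(1) by (auto simp: squarefree_def)
  then show False using \<open>n = _\<close> assms(2) by simp
qed

lemma square_diff_mod4:
  fixes a b d :: int
  assumes "d mod 4 = 1"
  shows "a ^ 2 - d * b ^ 2 \<noteq> 2" "d * a ^ 2 - b ^ 2 \<noteq> 2"
proof -
  have sq: "x ^ 2 mod 4 = 0 \<or> x ^ 2 mod 4 = 1" for x :: int
  proof -
    have "x mod 4 = 0 \<or> x mod 4 = 1 \<or> x mod 4 = 2 \<or> x mod 4 = 3" by presburger
    moreover have "x ^ 2 mod 4 = (x mod 4) ^ 2 mod 4" by (simp add: power_mod)
    ultimately show ?thesis by auto
  qed
  have m: "(d * x ^ 2) mod 4 = x ^ 2 mod 4" for x :: int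
    by (subst mod_mult_left_eq[symmetric]) (simp add: assms)
  have *: "A - B \<noteq> 2" if "A mod 4 = 0 \<or> A mod 4 = 1" "B mod 4 = 0 \<or> B mod 4 = 1" for A B :: int
  proof
    assume "A - B = 2"
    then have "A = B + 2" by simp
    then have "A mod 4 = (B mod 4 + 2) mod 4" by (simp add: mod_add_left_eq)
    then show False using that by auto
  qed
  show "a ^ 2 - d * b ^ 2 \<noteq> 2" "d * a ^ 2 - b ^ 2 \<noteq> 2"
    by (rule *; simp only: m sq)+
qed

text \<open>Meant for the trace \<open>t\<close> of a unit of norm 1 in the field of
  \<open>sqrt d\<close>; the equation in \<open>v\<close> is its discriminant. Substituting
  \<open>t + 2 = 2 * r ^ 2\<close> there and cancelling leaves \<open>r ^ 2 - 2 = d * w ^ 2\<close>,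
  while the class \<open>2 * d\<close> leaves \<open>d * r ^ 2 - 2 = w ^ 2\<close>. All these
  numbers are integers, and both equations fail modulo 4.\<close>

lemma trace_plus_two_not_twice_square:
  fixes t r v :: real and d :: nat
  assumes d: "squarefree d" "d mod 4 = 1" and t: "t \<in> \<int>" "t > 2"
    and v: "v \<in> \<rat>" "(t - 2) * (t + 2) = real d * v ^ 2" and r: "r \<in> \<rat>"
  shows "t + 2 \<noteq> 2 * r ^ 2" "squarefree (2 * d) \<Longrightarrow> t + 2 \<noteq> 2 * real d * r ^ 2"
proof -
  have dz: "d \<noteq> 0" using d(2) by (cases d) auto
  have dm: "int d mod 4 = 1" using d(2) by presburger
  have d2: "squarefree (2::nat)" by (simp add: squarefree_prime)
  show "t + 2 \<noteq> 2 * r ^ 2"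
  proof
    assume eq: "t + 2 = 2 * r ^ 2"
    have "2 * r ^ 2 \<in> \<int>" unfolding eq[symmetric] using t(1) by simp
    then have ri: "r \<in> \<int>" using rational_Ints_if_squarefree_mult_square[OF d2 r] by simp
    have rz: "r \<noteq> 0" using eq t(2) by auto
    define w where "w = v / (2 * r)"
    have "4 * r ^ 2 * (r ^ 2 - 2) = real d * v ^ 2"
    proof -
      have "t - 2 = 2 * r ^ 2 - 4" using eq by linarith
      then have "real d * v ^ 2 = (2 * r ^ 2 - 4) * (2 * r ^ 2)" unfolding v(2)[symmetric] eq by (simp only:)
      then show ?thesis by (simp add: algebra_simps)
    qed
    then have w: "r ^ 2 - 2 = real d * w ^ 2"
      using rz by (simp add: w_def field_simps power2_eq_square)
    have "r ^ 2 - 2 \<in> \<int>" using ri by simp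
    then have "w \<in> \<int>" using rational_Ints_if_squarefree_mult_square[OF d(1), of w] v(1) r w
      by (simp add: w_def)
    then obtain a b where ab: "w = of_int a" "r = of_int b" using ri by (auto elim!: Ints_cases)
    have "real_of_int (b ^ 2 - int d * a ^ 2) = of_int 2" using w ab by simp
    then have "b ^ 2 - int d * a ^ 2 = 2" by linarith
    then show False using square_diff_mod4(1)[OF dm] by blast
  qed
  show "t + 2 \<noteq> 2 * real d * r ^ 2" if sf: "squarefree (2 * d)"
  proof
    assume eq: "t + 2 = 2 * real d * r ^ 2"
    have "real (2 * d) * r ^ 2 \<in> \<int>" using eq[symmetric] t(1) by simp
    then have ri: "r \<in> \<int>" using rational_Ints_if_squarefree_mult_square[OF sf r] by simp
    have rz: "r \<noteq> 0" using eq t(2) by auto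
    define w where "w = v / (2 * r)"
    have "4 * r ^ 2 * (real d * r ^ 2 - 2) = v ^ 2"
    proof -
      have "t - 2 = 2 * real d * r ^ 2 - 4" using eq by linarith
      then have "real d * v ^ 2 = (2 * real d * r ^ 2 - 4) * (2 * real d * r ^ 2)"
        unfolding v(2)[symmetric] eq by (simp only:)
      also have "\<dots> = real d * (4 * r ^ 2 * (real d * r ^ 2 - 2))" by (simp add: algebra_simps)
      finally have "real d * v ^ 2 = real d * (4 * r ^ 2 * (real d * r ^ 2 - 2))" .
      then show ?thesis using dz by simp
    qed
    then have w: "real d * r ^ 2 - 2 = w ^ 2"
      using rz by (simp add: w_def field_simps power2_eq_square)
    have "real d * r ^ 2 - 2 \<in> \<int>" using ri by simp
    then have "w \<in> \<int>" using rational_Ints_if_squarefree_mult_square[of 1 w] v(1) r w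
      by (simp add: w_def)
    then obtain a b where ab: "w = of_int a" "r = of_int b" using ri by (auto elim!: Ints_cases)
    have "real_of_int (int d * b ^ 2 - a ^ 2) = of_int 2" using w ab by simp
    then have "int d * b ^ 2 - a ^ 2 = 2" by linarith
    then show False using square_diff_mod4(2)[OF dm] by blast
  qed
qed

text \<open>Suppose \<open>p\<close> has odd multiplicity in \<open>q\<close> but does not divide
  \<open>N\<close>, hence not \<open>D\<close>. Its multiplicity in the product is even, so it is
  odd in \<open>q'\<close> too, and \<open>p\<close> divides the gcd. Then \<open>p\<close> is 2,
  which divides \<open>N\<close> after all. So the squarefree part of \<open>q\<close> divides
  \<open>N\<close>.\<close>

lemma square_class_divides:
  fixes q q' D y N :: nat
  assumes eq: "q * q' = D * y ^ 2" and g: "gcd q q' dvd 4" and D: "D dvd N" "N \<noteq> 0" "2 dvd N"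
    and nz: "q \<noteq> 0" "q' \<noteq> 0"
  obtains m r where "m dvd N" "q = m * r ^ 2"
proof -
  define m where "m = squarefree_part q"
  have m0: "m \<noteq> 0" and sm: "squarefree m"
    using nz by (auto simp: m_def)
  have q: "q = m * square_part q ^ 2" unfolding m_def by (rule squarefree_decompose)
  have dz: "D \<noteq> 0" "y \<noteq> 0" by (rule notI, use eq nz in simp)+
  have "m dvd N"
  proof (rule multiplicity_le_imp_dvd[OF m0])
    fix p :: nat assume p: "prime p"
    have le: "multiplicity p m \<le> 1" using sm p m0 squarefree_factorial_semiring''[of m] by simp
    show "multiplicity p m \<le> multiplicity p N"
    proof (cases "p dvd m")
      case pm: True
      have "p dvd N"
      proof (rule ccontr)
        assume pN: "\<not> p dvd N"
        then have pD: "\<not> p dvd D" using D(1) dvd_trans by blast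
        have "multiplicity p m \<noteq> 0"
          using pm m0 p by (metis multiplicity_eq_zero_iff not_prime_unit)
        then have 1: "multiplicity p m = 1" using le by simp
        have "multiplicity p q = multiplicity p m + 2 * multiplicity p (square_part q)"
          using nz(1) m0 p
          by (subst q) (simp add: prime_elem_multiplicity_mult_distrib prime_elem_multiplicity_power_distrib)
        moreover have "multiplicity p q + multiplicity p q' = multiplicity p D + 2 * multiplicity p y"
          using nz dz p arg_cong[OF eq, of "multiplicity p"]
          by (simp add: prime_elem_multiplicity_mult_distrib prime_elem_multiplicity_power_distrib del: mult_eq_0_iff)
        moreover have "multiplicity p D = 0" using pD by (simp add: not_dvd_imp_multiplicity_0)
        ultimately have "odd (multiplicity p q')" using 1 by presburger
        then have "p dvd q'" using not_dvd_imp_multiplicity_0 by fastforce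
        moreover have "p dvd q" using pm q by (metis dvd_mult2)
        ultimately have "p dvd 2 ^ 2" using g dvd_trans[of p "gcd q q'" 4] by simp
        then have "p dvd 2" using p prime_dvd_power by blast
        then show False using pN D(3) dvd_trans by blast
      qed
      then have "multiplicity p N \<ge> 1" using p D(2)
        by (metis multiplicity_eq_zero_iff not_prime_unit less_one linorder_not_less)
      then show ?thesis using le by simp
    qed (simp add: not_dvd_imp_multiplicity_0)
  qed
  then show ?thesis using q that by blast
qed

section \<open>Fundamental units and the biquadratic field\<close>

lemma powi_inject:
  assumes "a > (1::real)" "a powi m = a powi n"
  shows "m = n"
  using power_int_strict_increasing[of m n a] power_int_strict_increasing[of n m a] assms
  by (cases m n rule: linorder_cases) auto

section \<open>Fundamental units of real quadratic fields\<close>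

locale quad_fund = quad_ext "\<rat>" s for s +
  fixes \<epsilon> :: real
  assumes eps_unit: "\<epsilon> \<in> real_units E" and eps_gt_1: "\<epsilon> > 1"
    and eps_generates: "u \<in> real_units E \<Longrightarrow> \<exists>n::int. u = \<epsilon> powi n \<or> u = - (\<epsilon> powi n)"
begin

lemma eps_in_E: "\<epsilon> \<in> E" using eps_unit by (simp add: real_units_def)

lemma nrm_eps_cases: "nrm \<epsilon> = 1 \<or> nrm \<epsilon> = -1"
  using nrm_units[OF eps_unit] by (auto simp: real_units_Rats)

text \<open>A square root would be a unit, hence up to sign a power with exponent \<open>n\<close>,
  and \<open>2 * n = 1\<close> would follow.\<close>

lemma eps_not_square:
  assumes "r \<in> E" shows "r ^ 2 \<noteq> \<epsilon>"
proof
  assume eq: "r ^ 2 = \<epsilon>"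
  then have "r \<in> real_units E" using real_units_root[OF subfield_E _ assms] eps_unit by simp
  then obtain n where "r = \<epsilon> powi n \<or> r = - (\<epsilon> powi n)" using eps_generates by blast
  then have "r ^ 2 = \<epsilon> powi (n * 2)"
    by (auto simp: power_int_mult)
  then have "\<epsilon> powi (n * 2) = \<epsilon> powi 1" using eq by simp
  then have "n * 2 = 1"
    using powi_inject[OF eps_gt_1] by blast
  then show False by presburger
qed

definition tr :: real where "tr = \<epsilon> + cj \<epsilon>"

lemma tr_Ints: "tr \<in> \<int>"
proof (rule rational_algebraic_int_is_int)
  show "algebraic_int tr" unfolding tr_def
    using eps_unit cj_units[OF eps_unit] by (intro algebraic_int_add_real) (auto simp: real_units_def)
  show "tr \<in> \<rat>" unfolding tr_def by (rule trace_in_F[OF eps_in_E])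
qed

text \<open>For norm 1 the left side is the discriminant of the polynomial with roots
  \<open>\<epsilon>\<close> and \<open>cj \<epsilon>\<close>, the square of their difference, and
  this difference is a rational multiple of \<open>s\<close>.\<close>

lemma eps_discriminant:
  assumes "nrm \<epsilon> = 1"
  obtains v where "v \<in> \<rat>" "(tr - 2) * (tr + 2) = s ^ 2 * v ^ 2"
proof -
  obtain u v where uv: "u \<in> \<rat>" "v \<in> \<rat>" "\<epsilon> = u + v * s" using eps_in_E by (rule mem_EE)
  have cj: "cj \<epsilon> = u - v * s" using uv cj_eq by simp
  have "(tr - 2) * (tr + 2) = tr ^ 2 - 4 * nrm \<epsilon>" using assms by (simp add: power2_eq_square algebra_simps)
  also have "\<dots> = (\<epsilon> - cj \<epsilon>) ^ 2" by (simp add: tr_def nrm_def power2_eq_square algebra_simps)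
  also have "\<epsilon> - cj \<epsilon> = s * (2 * v)" using uv(3) cj by simp
  finally show ?thesis using that[of "2 * v"] uv(2) by (simp add: power_mult_distrib)
qed

lemma tr_gt_2:
  assumes "nrm \<epsilon> = 1" shows "tr > 2"
proof -
  have "cj \<epsilon> = 1 / \<epsilon>" using assms eps_gt_1 by (simp add: nrm_def field_simps)
  moreover have "\<epsilon> + 1 / \<epsilon> - 2 = (\<epsilon> - 1) ^ 2 / \<epsilon>"
    using eps_gt_1 by (simp add: field_simps power2_eq_square)
  moreover have "(\<epsilon> - 1) ^ 2 / \<epsilon> > 0" using eps_gt_1 by simp
  ultimately show ?thesis by (simp add: tr_def)
qed

text \<open>Hilbert 90 for a unit of norm 1.\<close>
lemma eps_times_tr:
  assumes "nrm \<epsilon> = 1" shows "\<epsilon> * (tr + 2) = (1 + \<epsilon>) ^ 2"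
  using assms by (simp add: nrm_def tr_def power2_eq_square algebra_simps)

text \<open>By \<open>eps_times_tr\<close>, \<open>tr + 2\<close> and \<open>\<epsilon>\<close>
  differ by a square factor, and \<open>\<epsilon>\<close> is not a square in its own field.\<close>

lemma tr_not_square:
  assumes "nrm \<epsilon> = 1" "r \<in> E" shows "r ^ 2 \<noteq> tr + 2"
proof
  assume eq: "r ^ 2 = tr + 2"
  have "\<epsilon> = ((1 + \<epsilon>) / r) ^ 2"
    using eps_times_tr[OF assms(1)] tr_gt_2[OF assms(1)] eq by (simp add: field_simps)
  moreover have "(1 + \<epsilon>) / r \<in> E" using assms(2) eps_in_E by (simp add: E_intros)
  ultimately show False using eps_not_square by metis
qed

lemma pos_unit:
  assumes "u \<in> real_units E" "u > 0"
  obtains n :: int where "u = \<epsilon> powi n"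
proof -
  obtain n where "u = \<epsilon> powi n \<or> u = - (\<epsilon> powi n)" using eps_generates assms(1) by blast
  moreover have "\<epsilon> powi n > 0" using eps_gt_1 by simp
  ultimately show ?thesis using assms(2) that by auto
qed

end

lemma quad_ext_Rats_sqrt: "squarefree n \<Longrightarrow> n \<noteq> 1 \<Longrightarrow> quad_ext \<rat> (sqrt (real n))"
  using real_subfield_Rats sqrt_squarefree_irrational by (simp add: quad_ext_def)

section \<open>The biquadratic field over its three quadratic subfields\<close>

locale biquad_setting =
  fixes p1 p2 :: nat
  assumes primes: "prime p1" "prime p2" and neq: "p1 \<noteq> p2"
    and mod4: "p1 mod 4 = 1" "p2 mod 4 = 1"
begin

definition D :: nat where "D = p1 * p2"

abbreviation "r2 \<equiv> sqrt 2"
abbreviation "rd \<equiv> sqrt (real D)"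
abbreviation "r2d \<equiv> sqrt (2 * real D)"
abbreviation "k1 \<equiv> adjoin \<rat> r2"
abbreviation "k2 \<equiv> adjoin \<rat> rd"
abbreviation "k3 \<equiv> adjoin \<rat> r2d"
abbreviation "Kp \<equiv> adjoin k1 rd"

lemma D_pos: "D > 0" using primes by (simp add: D_def prime_gt_0_nat)

lemma D_mod4: "D mod 4 = 1"
  using mod4 mod_mult_eq[of p1 4 p2] by (simp add: D_def)

lemma squarefree_D: "squarefree D" and squarefree_2D: "squarefree (2 * D)"
proof -
  have c: "coprime p1 p2" using primes neq by (simp add: primes_coprime)
  show "squarefree D" unfolding D_def
    by (intro squarefree_mult_coprime c squarefree_prime primes)
  moreover have "coprime 2 D" using D_mod4 by simp presburger
  ultimately show "squarefree (2 * D)"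
    by (intro squarefree_mult_coprime) (simp_all add: squarefree_prime)
qed

text \<open>Primes that are 1 modulo 4 begin with 5 and 13, as 9 is not prime, so two distinct ones
  have product at least 65. This is the size that \<open>small_algebraic_integers\<close> relies
  on.\<close>

lemma D_gt_64: "D > 64"
proof -
  have g: "p \<ge> 5" if "prime p" "p mod 4 = 1" for p :: nat
    using that prime_gt_1_nat[of p] by presburger
  have "p1 \<ge> 5" "p2 \<ge> 5" using g primes mod4 by auto
  have "p1 \<ge> 13 \<or> p2 \<ge> 13"
  proof (rule ccontr)
    assume "\<not> ?thesis"
    then have "p1 < 13" "p2 < 13" by auto
    moreover have "p1 \<noteq> 9" "p2 \<noteq> 9" using primes by (auto simp: prime_nat_iff dest!: spec[of _ 3])
    ultimately have "p1 = 5" "p2 = 5" using mod4 \<open>p1 \<ge> 5\<close> \<open>p2 \<ge> 5\<close> by presburger+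
    then show False using neq by simp
  qed
  then have "p1 * p2 \<ge> 5 * 13"
    using mult_le_mono[OF \<open>p1 \<ge> 5\<close>, of 13 p2] mult_le_mono[OF _ \<open>p2 \<ge> 5\<close>, of 13 p1] by auto
  then show ?thesis by (simp add: D_def)
qed

lemma r2d: "r2d = r2 * rd" by (simp add: real_sqrt_mult)

lemma r2_r2: "r2 * r2 = 2" and rd_rd: "rd * rd = real D" by simp_all

lemma r2_nz: "r2 \<noteq> 0" by simp

sublocale Q1: quad_ext "\<rat>" r2
  using quad_ext_Rats_sqrt[of 2] by (simp add: squarefree_prime)
sublocale Q2: quad_ext "\<rat>" rd
  using quad_ext_Rats_sqrt[OF squarefree_D] D_gt_64 by simp
sublocale Q3: quad_ext "\<rat>" r2d
  using quad_ext_Rats_sqrt[OF squarefree_2D] by simp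

text \<open>The same field is built over each of its quadratic subfields: \<open>T\<close>,
  \<open>S\<close> and \<open>R\<close> provide the three nontrivial automorphisms, fixing
  \<open>k1\<close>, \<open>k2\<close> and \<open>k3\<close>. That the adjoined root is new follows
  each time from \<open>square_in_base\<close> one level down.\<close>

sublocale T: quad_ext k1 rd
proof
  show "real_subfield k1" by (rule Q1.subfield_E)
  show "rd * rd \<in> k1" by (simp add: Q1.base_in_E)
  show "rd \<notin> k1"
  proof
    assume "rd \<in> k1"
    then have "rd \<in> \<rat> \<or> (\<exists>v\<in>\<rat>. rd = v * r2)"
      using Q1.square_in_base[of rd] by simp
    then obtain v where "v \<in> \<rat>" "rd = v * r2" using Q2.s by blast
    then have "r2d = 2 * v" unfolding r2d by simp
    then show False using Q3.s \<open>v \<in> \<rat>\<close> by simp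
  qed
qed

sublocale S: quad_ext k2 r2
proof
  show "real_subfield k2" by (rule Q2.subfield_E)
  show "r2 * r2 \<in> k2" by (simp add: Q2.base_in_E)
  show "r2 \<notin> k2"
  proof
    assume "r2 \<in> k2"
    then have "r2 \<in> \<rat> \<or> (\<exists>v\<in>\<rat>. r2 = v * rd)"
      using Q2.square_in_base[of r2] by simp
    then obtain v where "v \<in> \<rat>" "r2 = v * rd" using Q1.s by blast
    then have "r2d = v * real D" unfolding r2d by simp
    then show False using Q3.s \<open>v \<in> \<rat>\<close> by simp
  qed
qed

sublocale R: quad_ext k3 r2
proof
  show "real_subfield k3" by (rule Q3.subfield_E)
  show "r2 * r2 \<in> k3" by (simp add: Q3.base_in_E)
  show "r2 \<notin> k3"
  proof
    assume "r2 \<in> k3"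
    then have "r2 \<in> \<rat> \<or> (\<exists>v\<in>\<rat>. r2 = v * r2d)"
      using Q3.square_in_base[of r2] by simp
    then obtain v where v: "v \<in> \<rat>" "r2 = v * r2d" using Q1.s by blast
    then have "r2 * 1 = r2 * (v * rd)" unfolding r2d by simp
    then have "v * rd = 1" using r2_nz by (metis mult_cancel_left)
    then have "rd = inverse v" by (metis inverse_unique)
    then show False using Q2.s \<open>v \<in> \<rat>\<close> by simp
  qed
qed

text \<open>Common rational coordinates in which the three towers are compared; each involution
  flips two of the last three signs.\<close>

definition emb :: "real \<Rightarrow> real \<Rightarrow> real \<Rightarrow> real \<Rightarrow> real" where
  "emb a b c e = a + b * r2 + c * rd + e * r2d"

lemma emb_T: "emb a b c e = (a + b * r2) + (c + e * r2) * rd"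
  and emb_S: "emb a b c e = (a + c * rd) + (b + e * rd) * r2"
  unfolding emb_def r2d by (simp_all only: algebra_simps)

text \<open>Over \<open>k3\<close> the element \<open>rd\<close> becomes
  \<open>r2d * r2 / 2\<close>, whence the halved coordinate.\<close>

lemma emb_R: "emb a b c e = (a + e * r2d) + (b + c / 2 * r2d) * r2"
proof -
  have "(a + e * r2d) + (b + c / 2 * r2d) * r2 = a + b * r2 + c / 2 * rd * (r2 * r2) + e * r2d"
    unfolding r2d by (simp only: algebra_simps)
  then show ?thesis by (simp add: emb_def)
qed

lemma mem_Kp_iff: "z \<in> Kp \<longleftrightarrow> (\<exists>a\<in>\<rat>. \<exists>b\<in>\<rat>. \<exists>c\<in>\<rat>. \<exists>e\<in>\<rat>. z = emb a b c e)"
  unfolding emb_T adjoin_def by fast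

lemma Kp_S: "adjoin k2 r2 = Kp"
proof -
  have "z \<in> adjoin k2 r2 \<longleftrightarrow> z \<in> Kp" for z
    unfolding mem_Kp_iff unfolding emb_S adjoin_def by fast
  then show ?thesis by blast
qed

lemma Kp_R: "adjoin k3 r2 = Kp"
proof (intro equalityI subsetI)
  fix z
  show "z \<in> Kp" if "z \<in> adjoin k3 r2"
  proof -
    from that obtain a e b c where "a \<in> \<rat>" "b \<in> \<rat>" "c \<in> \<rat>" "e \<in> \<rat>"
      "z = (a + e * r2d) + (b + c * r2d) * r2" unfolding adjoin_def by fast
    then show ?thesis unfolding mem_Kp_iff
      by (intro bexI[of _ a] bexI[of _ b] bexI[of _ "2*c"] bexI[of _ e]) (simp_all add: emb_R)
  qed
  show "z \<in> adjoin k3 r2" if z: "z \<in> Kp"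
  proof -
    from z obtain a b c e where "a \<in> \<rat>" "b \<in> \<rat>" "c \<in> \<rat>" "e \<in> \<rat>" "z = emb a b c e"
      unfolding mem_Kp_iff by blast
    then show ?thesis unfolding emb_R using Q3.mem_EI[of b "c / 2"] by (auto intro!: R.mem_EI Q3.mem_EI)
  qed
qed

lemma
  assumes "a \<in> \<rat>" "b \<in> \<rat>" "c \<in> \<rat>" "e \<in> \<rat>"
  shows T_emb: "T.cj (emb a b c e) = emb a b (-c) (-e)"
    and S_emb: "S.cj (emb a b c e) = emb a (-b) c (-e)"
    and R_emb: "R.cj (emb a b c e) = emb a (-b) (-c) e"
proof -
  show "T.cj (emb a b c e) = emb a b (-c) (-e)" unfolding emb_T using assms
    by (subst T.cj_eq) (auto intro!: Q1.mem_EI simp: algebra_simps)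
  show "S.cj (emb a b c e) = emb a (-b) c (-e)" unfolding emb_S using assms
    by (subst S.cj_eq) (auto intro!: Q2.mem_EI simp: algebra_simps)
  show "R.cj (emb a b c e) = emb a (-b) (-c) e" unfolding emb_R using assms Q3.mem_EI[of b "c / 2"]
    by (subst R.cj_eq) (auto intro!: Q3.mem_EI simp: algebra_simps)
qed

text \<open>The automorphisms form a Klein four-group.\<close>

lemma R_T: assumes "z \<in> Kp" shows "R.cj (T.cj z) = S.cj z"
  using assms unfolding mem_Kp_iff by (auto simp: T_emb R_emb S_emb)

text \<open>Kubota's identity for the three involutions of the biquadratic field.\<close>
lemma square_eq_norms:
  assumes "z \<in> Kp"
  shows "z ^ 2 * R.nrm (T.cj z) = T.nrm z * S.nrm z"
  by (simp add: T.nrm_def S.nrm_def R.nrm_def R_T[OF assms] power2_eq_square)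

text \<open>An involution fixing one quadratic subfield acts as the nontrivial conjugation on the
  other two, so there the relative norm is the norm to the rationals.\<close>

lemma T_k2: "z \<in> k2 \<Longrightarrow> T.nrm z = Q2.nrm z" and S_k1: "z \<in> k1 \<Longrightarrow> S.nrm z = Q1.nrm z"
  and T_k3: "z \<in> k3 \<Longrightarrow> T.nrm z = Q3.nrm z" and S_k3: "z \<in> k3 \<Longrightarrow> S.nrm z = Q3.nrm z"
  and R_k1: "z \<in> k1 \<Longrightarrow> R.nrm z = Q1.nrm z" and R_k2: "z \<in> k2 \<Longrightarrow> R.nrm z = Q2.nrm z"
proof -
  have 1: "S.cj z = Q1.cj z \<and> R.cj z = Q1.cj z" if "z \<in> k1"
  proof -
    from that obtain u v where "u \<in> \<rat>" "v \<in> \<rat>" "z = u + v * r2" by (rule Q1.mem_EE)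
    then show ?thesis using S_emb[of u v 0 0] R_emb[of u v 0 0] Q1.cj_eq[of u v] by (simp add: emb_def)
  qed
  have 2: "T.cj z = Q2.cj z \<and> R.cj z = Q2.cj z" if "z \<in> k2"
  proof -
    from that obtain u v where "u \<in> \<rat>" "v \<in> \<rat>" "z = u + v * rd" by (rule Q2.mem_EE)
    then show ?thesis using T_emb[of u 0 v 0] R_emb[of u 0 v 0] Q2.cj_eq[of u v] by (simp add: emb_def)
  qed
  have 3: "T.cj z = Q3.cj z \<and> S.cj z = Q3.cj z" if "z \<in> k3"
  proof -
    from that obtain u v where "u \<in> \<rat>" "v \<in> \<rat>" "z = u + v * r2d" by (rule Q3.mem_EE)
    then show ?thesis using T_emb[of u 0 0 v] S_emb[of u 0 0 v] Q3.cj_eq[of u v] by (simp add: emb_def)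
  qed
  show "z \<in> k2 \<Longrightarrow> T.nrm z = Q2.nrm z" "z \<in> k1 \<Longrightarrow> S.nrm z = Q1.nrm z"
    "z \<in> k3 \<Longrightarrow> T.nrm z = Q3.nrm z" "z \<in> k3 \<Longrightarrow> S.nrm z = Q3.nrm z"
    "z \<in> k1 \<Longrightarrow> R.nrm z = Q1.nrm z" "z \<in> k2 \<Longrightarrow> R.nrm z = Q2.nrm z"
    using 1 2 3
    by (simp_all add: T.nrm_def S.nrm_def R.nrm_def Q1.nrm_def Q2.nrm_def Q3.nrm_def)
qed

lemma k1_Kp: "z \<in> k1 \<Longrightarrow> z \<in> Kp" and k2_Kp: "z \<in> k2 \<Longrightarrow> z \<in> Kp" and k3_Kp: "z \<in> k3 \<Longrightarrow> z \<in> Kp"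
  using T.base_in_E S.base_in_E R.base_in_E by (simp_all add: Kp_S Kp_R)

text \<open>Two applications of \<open>square_in_base\<close>, first over \<open>k1\<close> and then
  over the rationals, each contributing an optional factor \<open>D\<close> or 2.\<close>

lemma rational_square_in_Kp:
  assumes "r \<in> Kp" "r ^ 2 \<in> \<rat>"
  obtains m w where "m \<in> {1, 2, real D, 2 * real D}" "w \<in> \<rat>" "r ^ 2 = m * w ^ 2"
proof -
  have k1: "\<exists>m\<in>{1,2}. \<exists>w\<in>\<rat>. z ^ 2 = m * w ^ 2" if z: "z \<in> k1" "z ^ 2 \<in> \<rat>" for z
  proof -
    from Q1.square_in_base[OF z] show ?thesis
    proof
      assume "\<exists>v\<in>\<rat>. z = v * r2"
      then obtain v where "v \<in> \<rat>" "z = v * r2" by blast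
      then show ?thesis by (intro bexI[of _ 2] bexI[of _ v]) (auto simp: power_mult_distrib)
    qed auto
  qed
  have "r ^ 2 \<in> k1" using assms(2) by (rule Q1.base_in_E)
  from T.square_in_base[OF assms(1) this] show ?thesis
  proof
    assume "r \<in> k1"
    from k1[OF this assms(2)] obtain m w where "m \<in> {1,2}" "w \<in> \<rat>" "r ^ 2 = m * w ^ 2" by blast
    then show ?thesis using that[of m w] by blast
  next
    assume "\<exists>v\<in>k1. r = v * rd"
    then obtain v where v: "v \<in> k1" "r = v * rd" by blast
    have "v ^ 2 = r ^ 2 / real D" using v(2) D_pos by (simp add: power_mult_distrib)
    then have "v ^ 2 \<in> \<rat>" using assms(2) by simp
    from k1[OF v(1) this] obtain m w where "m \<in> {1,2}" "w \<in> \<rat>" "v ^ 2 = m * w ^ 2" by blast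
    then show ?thesis using that[of "m * real D" w] v(2) by (auto simp: power_mult_distrib)
  qed
qed

end

section \<open>Units of the biquadratic field\<close>

lemma minus_one_powi: "(-1::real) powi n = (if even n then 1 else -1)"
  by (auto simp: power_int_def even_nat_iff)

lemma sign_powi_cases: "s = 1 \<or> s = -1 \<Longrightarrow> (s::real) powi n = 1 \<or> s powi n = -1"
  by (auto simp: minus_one_powi split: if_splits)

lemma power2_powi: "((x::real) powi n) ^ 2 = x powi (2 * n)"
  using power_int_mult[of x n 2] by (simp add: mult.commute)

section \<open>Square classes of rational integers in the biquadratic field\<close>

context biquad_setting
begin

lemmas Kp_intros = T.E_intros

lemma rd_Kp: "rd \<in> Kp" by (rule T.s_in_E)
lemma r2_Kp: "r2 \<in> Kp" by (rule k1_Kp[OF Q1.s_in_E])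

text \<open>The divisors 1, 2, \<open>D\<close>, \<open>2 * D\<close> have their roots in
  \<open>Kp\<close>, and multiplication by \<open>p1\<close> carries the other four divisors to
  these up to squares.\<close>

lemma sqrt_divisor_in_Kp:
  assumes "m dvd 2 * p1 * p2"
  shows "sqrt (real m) \<in> Kp \<or> sqrt (real (p1 * m)) \<in> Kp"
proof -
  obtain a b where a: "m = a * b" "a dvd 2 * p1" "b dvd p2"
    using division_decomp[OF assms] by blast
  obtain c e where c: "a = c * e" "c dvd 2" "e dvd p1"
    using division_decomp[OF a(2)] by blast
  have cases: "c = 1 \<or> c = 2" "e = 1 \<or> e = p1" "b = 1 \<or> b = p2"
    using c a(3) primes two_is_prime_nat by (auto simp: prime_nat_iff)
  have D: "sqrt (real p1) * sqrt (real p2) \<in> Kp" "sqrt (real p2) * sqrt (real p1) \<in> Kp"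
    "sqrt (real p1) * sqrt (real p1) \<in> Kp"
    using rd_Kp subfield_of_nat[OF T.subfield_E, of p1] by (simp_all add: D_def real_sqrt_mult mult.commute)
  have "sqrt (real c) \<in> Kp" using cases(1) r2_Kp by (auto simp: Kp_intros)
  moreover have eb: "sqrt (real e * real b) \<in> Kp \<or> sqrt (real p1 * (real e * real b)) \<in> Kp"
    using cases(2,3) D Kp_intros(2) by (elim disjE) (simp_all add: real_sqrt_mult)
  ultimately have "sqrt (real c) * sqrt (real e * real b) \<in> Kp \<or> sqrt (real c) * sqrt (real p1 * (real e * real b)) \<in> Kp"
    using T.mult_in_E eb by blast
  then show ?thesis by (simp add: a(1) c(1) real_sqrt_mult mult_ac)
qed

text \<open>The integers \<open>t + 2\<close> and \<open>t - 2\<close> differ by 4 and their product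
  is \<open>n\<close> times a square, so \<open>t + 2\<close> is a divisor of \<open>2 * D\<close>
  times a square. Up to the factor \<open>p1\<close> such a divisor is a square in
  \<open>Kp\<close>.\<close>

lemma square_class_in_Kp:
  assumes t: "t \<in> \<int>" "t > 2" and n: "n dvd 2 * D" "squarefree n"
    and v: "v \<in> \<rat>" "(t - 2) * (t + 2) = real n * v ^ 2"
  obtains r where "r \<in> Kp" "r ^ 2 = t + 2 \<or> r ^ 2 = real p1 * (t + 2)"
proof -
  have "(t - 2) * (t + 2) \<in> \<int>" using t(1) by simp
  then have "real n * v ^ 2 \<in> \<int>" using v(2) by simp
  then have "v \<in> \<int>" using rational_Ints_if_squarefree_mult_square[OF n(2) v(1)] by blast
  then obtain z where z: "v = of_int z" by (auto elim: Ints_cases)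
  from t obtain k where k: "t = of_int k" by (auto elim: Ints_cases)
  then have k2: "k > 2" using t(2) by simp
  define q where "q = nat (k + 2)"
  define q' where "q' = nat (k - 2)"
  have q: "real q = t + 2" "real q' = t - 2" using k k2 by (simp_all add: q_def q'_def)
  have "real (q * q') = real (n * nat \<bar>z\<bar> ^ 2)" using v(2) q z by (simp add: mult.commute)
  then have eq: "q * q' = n * nat \<bar>z\<bar> ^ 2" by linarith
  have "q = q' + 4" using k2 by (simp add: q_def q'_def)
  then have g: "gcd q q' dvd 4"
    by (metis dvd_add_right_iff gcd_dvd1 gcd_dvd2)
  have nz: "q \<noteq> 0" "q' \<noteq> 0" using k2 by (simp_all add: q_def q'_def)
  have "2 * D \<noteq> 0" "2 dvd 2 * D" using D_pos by simp_all
  then obtain m r where m: "m dvd 2 * D" "q = m * r ^ 2"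
    using square_class_divides[OF eq g n(1) _ _ nz] by blast
  then have tr: "t + 2 = real m * real r ^ 2" using q(1) by simp
  have "m dvd 2 * p1 * p2" using m(1) by (simp add: D_def mult.assoc)
  then consider "sqrt (real m) \<in> Kp" | "sqrt (real (p1 * m)) \<in> Kp"
    using sqrt_divisor_in_Kp by blast
  then show ?thesis
  proof cases
    case 1
    show ?thesis
      by (rule that[of "sqrt (real m) * real r"])
        (simp_all add: 1 Kp_intros subfield_of_nat[OF T.subfield_E] tr power_mult_distrib)
  next
    case 2
    show ?thesis
      by (rule that[of "sqrt (real (p1 * m)) * real r"])
        (use 2 in \<open>simp_all add: Kp_intros subfield_of_nat[OF T.subfield_E] tr power_mult_distrib\<close>)
  qed
qed

end

section \<open>Monomials in the three fundamental units\<close>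

locale biquad_units = biquad_setting +
  fixes \<epsilon>1 \<epsilon>2 \<epsilon>3 :: real
  assumes fund: "quad_fund r2 \<epsilon>1" "quad_fund rd \<epsilon>2" "quad_fund r2d \<epsilon>3"
begin

sublocale U1: quad_fund r2 \<epsilon>1 by (rule fund)
sublocale U2: quad_fund rd \<epsilon>2 by (rule fund)
sublocale U3: quad_fund r2d \<epsilon>3 by (rule fund)

definition N2 where "N2 = Q2.nrm \<epsilon>2"
definition N3 where "N3 = Q3.nrm \<epsilon>3"

definition mon :: "int \<Rightarrow> int \<Rightarrow> int \<Rightarrow> real" where
  "mon a b c = \<epsilon>1 powi a * \<epsilon>2 powi b * \<epsilon>3 powi c"

lemma N2_cases: "N2 = 1 \<or> N2 = -1" and N3_cases: "N3 = 1 \<or> N3 = -1"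
  using U2.nrm_eps_cases U3.nrm_eps_cases by (auto simp: N2_def N3_def)

text \<open>The unit \<open>1 + r2\<close> has norm -1 and is a power of \<open>\<epsilon>1\<close>;
  a generator of norm 1 would have only powers of norm 1. This avoids computing
  \<open>\<epsilon>1\<close>.\<close>

lemma nrm_eps1: "Q1.nrm \<epsilon>1 = -1"
proof (rule ccontr)
  assume "Q1.nrm \<epsilon>1 \<noteq> -1"
  then have N: "Q1.nrm \<epsilon>1 = 1" using U1.nrm_eps_cases by simp
  have inv: "inverse (1 + r2) = r2 - 1" by (rule inverse_unique) (simp add: algebra_simps)
  have ai: "algebraic_int r2" using algebraic_int_sqrt[of 2] int_imp_algebraic_int[of "2::real"] by simp
  have "algebraic_int (1 + r2)" "algebraic_int (r2 + -1)"
    by (intro algebraic_int_add_real ai int_imp_algebraic_int; simp)+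
  moreover have "1 + r2 \<in> k1" by (simp add: Q1.E_intros Q1.s_in_E)
  moreover have "1 + r2 \<noteq> 0" using real_sqrt_ge_zero[of 2] by linarith
  ultimately have u: "1 + r2 \<in> real_units k1" by (simp add: real_units_def inv)
  have "1 + r2 > 0" using real_sqrt_ge_zero[of 2] by linarith
  from U1.pos_unit[OF u this] obtain n :: int where "1 + r2 = \<epsilon>1 powi n" by blast
  then have "Q1.nrm (1 + r2) = 1" using N U1.eps_in_E by (simp add: Q1.nrm_powi)
  moreover have "Q1.nrm (1 + r2) = -1"
  proof -
    have "Q1.cj (1 + r2) = 1 - r2" using Q1.cj_eq[of 1 1] by simp
    then have "Q1.nrm (1 + r2) = (1 + r2) * (1 - r2)" by (simp only: Q1.nrm_def)
    then show ?thesis by (simp add: algebra_simps)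
  qed
  ultimately show False by simp
qed

lemma eps_Kp: "\<epsilon>1 \<in> Kp" "\<epsilon>2 \<in> Kp" "\<epsilon>3 \<in> Kp"
  using U1.eps_in_E U2.eps_in_E U3.eps_in_E k1_Kp k2_Kp k3_Kp by auto

lemma eps_pos: "\<epsilon>1 > 0" "\<epsilon>2 > 0" "\<epsilon>3 > 0"
  using U1.eps_gt_1 U2.eps_gt_1 U3.eps_gt_1 by auto

lemma eps_units: "\<epsilon>1 \<in> real_units Kp" "\<epsilon>2 \<in> real_units Kp" "\<epsilon>3 \<in> real_units Kp"
  using U1.eps_unit U2.eps_unit U3.eps_unit eps_Kp by (auto simp: real_units_def)

lemma mon_pos: "mon a b c > 0" using eps_pos by (simp add: mon_def)

lemma mon_Kp: "mon a b c \<in> Kp" using eps_Kp by (simp add: mon_def Kp_intros)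

lemma mon_mult: "mon a b c * mon a' b' c' = mon (a + a') (b + b') (c + c')"
  using eps_pos by (simp add: mon_def power_int_add)

lemma mon_power2: "mon a b c ^ 2 = mon (2 * a) (2 * b) (2 * c)"
  by (simp add: power2_eq_square mon_mult)

lemma mon_powi: "mon a b c powi n = mon (a * n) (b * n) (c * n)"
  by (simp add: mon_def power_int_mult_distrib power_int_mult)

text \<open>Each of the three relative norms squares the fundamental unit of its fixed field and
  turns the other two units into signs.\<close>

lemma T_mon: "T.nrm (mon a b c) = \<epsilon>1 powi (2 * a) * N2 powi b * N3 powi c"
  using U1.eps_in_E U2.eps_in_E U3.eps_in_E eps_Kp
  by (simp add: mon_def T.nrm_mult T.nrm_powi T.nrm_base T_k2 T_k3 N2_def N3_def Kp_intros
      power_int_power' power_int_mult power2_powi)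

lemma S_mon: "S.nrm (mon a b c) = \<epsilon>2 powi (2 * b) * (-1) powi a * N3 powi c"
  using U1.eps_in_E U2.eps_in_E U3.eps_in_E eps_Kp
  by (simp add: mon_def S.nrm_mult S.nrm_powi S.nrm_base S_k1 S_k3 nrm_eps1 N3_def Kp_intros Kp_S
      power_int_mult)

lemma R_mon: "R.nrm (mon a b c) = \<epsilon>3 powi (2 * c) * (-1) powi a * N2 powi b"
  using U1.eps_in_E U2.eps_in_E U3.eps_in_E eps_Kp
  by (simp add: mon_def R.nrm_mult R.nrm_powi R.nrm_base R_k1 R_k2 nrm_eps1 N2_def Kp_intros Kp_R
      power_int_mult)

text \<open>Each relative norm isolates one exponent: an even power of a single unit times signs
  equals 1, so by positivity the power itself is 1.\<close>

lemma mon_independent: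
  assumes "mon a b c = 1" shows "a = 0 \<and> b = 0 \<and> c = 0"
proof -
  have *: "n = 0" if "x powi (2 * n) * s * t = 1" "x > 1" "s = 1 \<or> s = -1" "t = 1 \<or> t = -1" for x s t :: real and n
  proof -
    have "x powi (2 * n) > 0" using that by simp
    then have "x powi (2 * n) \<noteq> -1" by linarith
    then have "x powi (2 * n) = x powi 0" using that by auto
    then show ?thesis using powi_inject[OF that(2)] by fastforce
  qed
  have "T.nrm (mon a b c) = 1" "S.nrm (mon a b c) = 1" "R.nrm (mon a b c) = 1"
    using assms by (simp_all add: T.nrm_base S.nrm_base R.nrm_base Q1.E_intros Q2.E_intros Q3.E_intros)
  then show ?thesis unfolding T_mon S_mon R_mon
    using U1.eps_gt_1 U2.eps_gt_1 U3.eps_gt_1 sign_powi_cases N2_cases N3_cases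
    by (intro conjI; elim *) blast+
qed

text \<open>The relative norms of \<open>r\<close> are real, so the norms of its square are
  nonnegative, and the sign in each of the three norm formulas must be +1. These are the parity
  constraints used in every case.\<close>

lemma square_mon_signs:
  assumes "r \<in> Kp" "r ^ 2 = mon a b c"
  shows "N2 powi b * N3 powi c = 1" "(-1) powi a * N3 powi c = 1" "(-1) powi a * N2 powi b = 1"
proof -
  have *: "s * t = 1" if "y ^ 2 = x powi (2 * n) * s * t" "x > 1" "s = 1 \<or> s = -1" "t = 1 \<or> t = -1" for x y s t :: real and n
  proof -
    have "x powi (2 * n) > 0" using that by simp
    moreover have "x powi (2 * n) * (s * t) \<ge> 0" using that(1) by (metis mult.assoc zero_le_power2)
    ultimately show ?thesis using that(3,4) by auto
  qed
  have "T.nrm r ^ 2 = T.nrm (mon a b c)" "S.nrm r ^ 2 = S.nrm (mon a b c)" "R.nrm r ^ 2 = R.nrm (mon a b c)"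
    using assms(1) unfolding assms(2)[symmetric]
    by (simp_all add: T.nrm_power S.nrm_power R.nrm_power Kp_S Kp_R)
  note n = this[unfolded T_mon S_mon R_mon]
  show "N2 powi b * N3 powi c = 1" by (rule *[OF n(1) U1.eps_gt_1]) (simp_all add: sign_powi_cases N2_cases N3_cases)
  show "(-1) powi a * N3 powi c = 1" by (rule *[OF n(2) U2.eps_gt_1]) (simp_all add: sign_powi_cases N2_cases N3_cases)
  show "(-1) powi a * N2 powi b = 1" by (rule *[OF n(3) U3.eps_gt_1]) (simp_all add: sign_powi_cases N2_cases N3_cases)
qed

text \<open>In Kubota's identity all three norms are units of quadratic fields, hence signed powers
  of fundamental units. Absolute values remove the signs since \<open>z ^ 2\<close> is positive; the
  third exponent is negated because that norm is divided by.\<close>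

lemma square_of_unit:
  assumes "z \<in> real_units Kp"
  obtains a b c where "z ^ 2 = mon a b c"
proof -
  have z: "z \<in> Kp" "z \<noteq> 0" using assms by (auto simp: real_units_def)
  have "T.nrm z \<in> real_units k1" using assms by (rule T.nrm_units)
  then obtain a where a: "T.nrm z = \<epsilon>1 powi a \<or> T.nrm z = - (\<epsilon>1 powi a)" using U1.eps_generates by blast
  have "S.nrm z \<in> real_units k2" using assms S.nrm_units by (simp add: Kp_S)
  then obtain b where b: "S.nrm z = \<epsilon>2 powi b \<or> S.nrm z = - (\<epsilon>2 powi b)" using U2.eps_generates by blast
  have "R.nrm (T.cj z) \<in> real_units k3" using T.cj_units[OF assms] R.nrm_units by (simp add: Kp_R)
  then obtain c where c: "R.nrm (T.cj z) = \<epsilon>3 powi c \<or> R.nrm (T.cj z) = - (\<epsilon>3 powi c)" using U3.eps_generates by blast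
  have p: "\<epsilon>1 powi a > 0" "\<epsilon>2 powi b > 0" "\<epsilon>3 powi c > 0" using eps_pos by auto
  have "z ^ 2 * R.nrm (T.cj z) = T.nrm z * S.nrm z" by (rule square_eq_norms[OF z(1)])
  then have "z ^ 2 = T.nrm z * S.nrm z / R.nrm (T.cj z)" using c p by (auto simp: eq_divide_eq)
  then have "\<bar>z ^ 2\<bar> = \<bar>T.nrm z\<bar> * \<bar>S.nrm z\<bar> / \<bar>R.nrm (T.cj z)\<bar>" by (simp add: abs_mult)
  moreover have "\<bar>T.nrm z\<bar> = \<epsilon>1 powi a" using a p by auto
  moreover have "\<bar>S.nrm z\<bar> = \<epsilon>2 powi b" using b p by auto
  moreover have "\<bar>R.nrm (T.cj z)\<bar> = \<epsilon>3 powi c" using c p by auto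
  ultimately have "z ^ 2 = mon a b (- c)" by (simp add: mon_def power_int_minus divide_inverse)
  then show ?thesis by (rule that)
qed

text \<open>The classes 1 and \<open>D\<close> consist of squares in \<open>k2\<close>, where
  \<open>\<epsilon>2\<close> is not a square; the classes 2 and \<open>2 * D\<close> fail modulo
  4.\<close>

lemma tr2_square_class:
  assumes "N2 = 1" "m \<in> {1, 2, real D, 2 * real D}" "w \<in> \<rat>"
  shows "U2.tr + 2 \<noteq> m * w ^ 2"
proof -
  have N: "Q2.nrm \<epsilon>2 = 1" using assms(1) by (simp add: N2_def)
  obtain v where v: "v \<in> \<rat>" "(U2.tr - 2) * (U2.tr + 2) = rd ^ 2 * v ^ 2" using U2.eps_discriminant[OF N] by blast
  have v': "(U2.tr - 2) * (U2.tr + 2) = real D * v ^ 2" using v(2) by simp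
  note c = trace_plus_two_not_twice_square[OF squarefree_D D_mod4 U2.tr_Ints U2.tr_gt_2[OF N] v(1) v' assms(3)]
  have "w ^ 2 \<noteq> U2.tr + 2" "(w * rd) ^ 2 \<noteq> U2.tr + 2"
    by (intro U2.tr_not_square[OF N]; use assms(3) in \<open>simp add: Q2.E_intros Q2.base_in_E Q2.s_in_E\<close>)+
  then show ?thesis using c(1) c(2)[OF squarefree_2D] assms(2) by (auto simp: power_mult_distrib mult.commute)
qed

lemma tr2_not_square:
  assumes "N2 = 1" "r \<in> Kp" shows "r ^ 2 \<noteq> U2.tr + 2"
proof
  assume eq: "r ^ 2 = U2.tr + 2"
  then have "r ^ 2 \<in> \<rat>" using U2.tr_Ints Ints_subset_Rats by (metis Rats_add Rats_number_of subsetD)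
  from rational_square_in_Kp[OF assms(2) this] eq tr2_square_class[OF assms(1)] show False by metis
qed

text \<open>Since \<open>\<epsilon>2 * (tr + 2)\<close> is a square, a root of
  \<open>\<epsilon>2\<close> would give one of the rational number \<open>tr + 2\<close>, and all
  rational square classes of \<open>Kp\<close> are excluded.\<close>

lemma eps2_not_square:
  assumes "N2 = 1" "r \<in> Kp" shows "r ^ 2 \<noteq> \<epsilon>2"
proof
  assume eq: "r ^ 2 = \<epsilon>2"
  have "\<epsilon>2 * (U2.tr + 2) = (1 + \<epsilon>2) ^ 2" using U2.eps_times_tr assms(1) by (simp add: N2_def)
  then have "((1 + \<epsilon>2) / r) ^ 2 = U2.tr + 2" using eq eps_pos by (simp add: field_simps)
  moreover have "(1 + \<epsilon>2) / r \<in> Kp" using assms(2) eps_Kp by (simp add: Kp_intros)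
  ultimately show False using tr2_not_square[OF assms(1)] by blast
qed

text \<open>Each unit has the square class of its trace plus 2. Neither class is trivial, so by
  \<open>square_class_in_Kp\<close> both are the class of \<open>p1\<close>, and they cancel in the
  product.\<close>

lemma eps2_eps3_square:
  assumes N: "N2 = 1" "N3 = 1" and ns: "\<nexists>r. r \<in> Kp \<and> r ^ 2 = \<epsilon>3"
  obtains r where "r \<in> Kp" "r ^ 2 = \<epsilon>2 * \<epsilon>3"
proof -
  have N': "Q2.nrm \<epsilon>2 = 1" "Q3.nrm \<epsilon>3 = 1" using N by (simp_all add: N2_def N3_def)
  obtain v2 where v2: "v2 \<in> \<rat>" "(U2.tr - 2) * (U2.tr + 2) = rd ^ 2 * v2 ^ 2" using U2.eps_discriminant[OF N'(1)] by blast
  obtain v3 where v3: "v3 \<in> \<rat>" "(U3.tr - 2) * (U3.tr + 2) = r2d ^ 2 * v3 ^ 2" using U3.eps_discriminant[OF N'(2)] by blast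
  obtain s where s: "s \<in> Kp" "s ^ 2 = U2.tr + 2 \<or> s ^ 2 = real p1 * (U2.tr + 2)"
    using square_class_in_Kp[OF U2.tr_Ints U2.tr_gt_2[OF N'(1)] _ squarefree_D v2(1)] v2(2) by auto
  then have s2: "s ^ 2 = real p1 * (U2.tr + 2)" using tr2_not_square[OF N(1)] by blast
  obtain t where t: "t \<in> Kp" "t ^ 2 = U3.tr + 2 \<or> t ^ 2 = real p1 * (U3.tr + 2)"
    using square_class_in_Kp[OF U3.tr_Ints U3.tr_gt_2[OF N'(2)] _ squarefree_2D v3(1)] v3(2) by auto
  have tr_pos: "U2.tr + 2 > 0" "U3.tr + 2 > 0" using U2.tr_gt_2[OF N'(1)] U3.tr_gt_2[OF N'(2)] by auto
  have "t ^ 2 \<noteq> U3.tr + 2"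
  proof
    assume "t ^ 2 = U3.tr + 2"
    then have "((1 + \<epsilon>3) / t) ^ 2 = \<epsilon>3" using U3.eps_times_tr[OF N'(2)] tr_pos by (simp add: field_simps)
    moreover have "(1 + \<epsilon>3) / t \<in> Kp" using t(1) eps_Kp by (simp add: Kp_intros)
    ultimately show False using ns by blast
  qed
  then have t2: "t ^ 2 = real p1 * (U3.tr + 2)" using t(2) by blast
  have p: "real p1 \<noteq> 0" using primes prime_gt_0_nat by auto
  \<comment> \<open>The quotient of the square roots of \<open>\<epsilon>2 * (tr + 2)\<close> and
    \<open>\<epsilon>3 * (tr + 2)\<close> by those of the two traces plus 2; \<open>s\<close> and
    \<open>t\<close> each carry an extra root of \<open>p1\<close>.\<close>
  define r where "r = (1 + \<epsilon>2) * (1 + \<epsilon>3) * real p1 / (s * t)"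
  have "r ^ 2 = (\<epsilon>2 * (U2.tr + 2)) * (\<epsilon>3 * (U3.tr + 2)) * real p1 ^ 2 / (s ^ 2 * t ^ 2)"
    unfolding r_def U2.eps_times_tr[OF N'(1)] U3.eps_times_tr[OF N'(2)] by (simp add: power_mult_distrib power_divide)
  also have "\<dots> = \<epsilon>2 * \<epsilon>3" unfolding s2 t2 power2_eq_square[of "real p1"] using tr_pos p by simp
  finally have "r ^ 2 = \<epsilon>2 * \<epsilon>3" .
  moreover have "r \<in> Kp" unfolding r_def using s(1) t(1) eps_Kp by (simp add: Kp_intros subfield_of_nat[OF T.subfield_E])
  ultimately show ?thesis using that by blast
qed

text \<open>A basis of the units modulo sign. Only the third member varies, since every case of the
  theorem keeps \<open>\<epsilon>1\<close> and \<open>\<epsilon>2\<close>.\<close>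

definition real_basis :: "real \<Rightarrow> bool" where
  "real_basis \<theta> \<longleftrightarrow> \<theta> \<in> real_units Kp \<and> \<theta> > 0 \<and>
    (\<forall>z \<in> real_units Kp. \<exists>a b c::int. \<bar>z\<bar> = \<epsilon>1 powi a * \<epsilon>2 powi b * \<theta> powi c) \<and>
    (\<forall>a b c::int. \<epsilon>1 powi a * \<epsilon>2 powi b * \<theta> powi c = 1 \<longrightarrow> a = 0 \<and> b = 0 \<and> c = 0)"

lemma power2_eq_imp_abs: "x ^ 2 = y ^ 2 \<Longrightarrow> y > 0 \<Longrightarrow> \<bar>x\<bar> = (y::real)"
  by (metis abs_of_pos power2_eq_iff abs_minus_cancel)

text \<open>The square of any unit is a monomial; if all its exponents are even, the unit is a
  monomial up to sign.\<close>

lemma real_basis_eps3: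
  assumes "\<And>r a b c. r \<in> Kp \<Longrightarrow> r ^ 2 = mon a b c \<Longrightarrow> even a \<and> even b \<and> even c"
  shows "real_basis \<epsilon>3"
  unfolding real_basis_def mon_def[symmetric]
proof (intro conjI ballI)
  fix z assume z: "z \<in> real_units Kp"
  obtain a b c where eq: "z ^ 2 = mon a b c" using square_of_unit[OF z] .
  then have "even a \<and> even b \<and> even c" using assms z by (auto simp: real_units_def)
  then obtain a' b' c' where "a = 2 * a'" "b = 2 * b'" "c = 2 * c'" by (auto elim!: evenE)
  then have "z ^ 2 = mon a' b' c' ^ 2" using eq by (simp add: mon_power2)
  then show "\<exists>a b c. \<bar>z\<bar> = mon a b c" using power2_eq_imp_abs mon_pos by blast
qed (use eps_units eps_pos mon_independent in auto)

text \<open>The parity hypothesis says that modulo 2 the exponents of a square monomial are a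
  multiple of \<open>(i, j, 1)\<close>. Taking \<open>c\<close> as exponent of
  \<open>\<theta>\<close> leaves even exponents for the other two, and independence is inherited by
  squaring.\<close>

lemma real_basis_sqrt:
  assumes th: "r \<in> Kp" "r ^ 2 = mon i j 1" "\<theta> = sqrt (mon i j 1)"
    and par: "\<And>r a b c. r \<in> Kp \<Longrightarrow> r ^ 2 = mon a b c \<Longrightarrow> even (a - i * c) \<and> even (b - j * c)"
  shows "real_basis \<theta>"
proof -
  have th2: "\<theta> ^ 2 = mon i j 1" using th(3) mon_pos[of i j 1] by simp
  have "\<theta> = \<bar>r\<bar>" using th(2,3) by (metis real_sqrt_abs)
  then have thK: "\<theta> \<in> Kp" using th(1) by (cases "r \<ge> 0") (auto simp: Kp_intros)
  have pos: "\<theta> > 0" using th(3) mon_pos by simp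
  have "mon i j 1 \<in> real_units Kp" unfolding mon_def
    using eps_units by (intro real_units_mult real_units_powi T.subfield_E)
  then have unit: "\<theta> \<in> real_units Kp"
    using real_units_root[OF T.subfield_E] thK th2 by metis
  have sq: "(\<epsilon>1 powi a * \<epsilon>2 powi b * \<theta> powi c) ^ 2 = mon (2 * a + i * c) (2 * b + j * c) c" for a b c
  proof -
    have "(\<epsilon>1 powi a * \<epsilon>2 powi b * \<theta> powi c) ^ 2 = mon a b 0 ^ 2 * (\<theta> ^ 2) powi c"
      by (simp add: mon_def power_mult_distrib power2_powi power_int_power)
    also have "\<dots> = mon (2 * a + i * c) (2 * b + j * c) c"
      by (simp add: th2 mon_powi mon_power2 mon_mult)
    finally show ?thesis .
  qed
  show ?thesis unfolding real_basis_def
  proof (intro conjI ballI allI impI)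
    fix z assume z: "z \<in> real_units Kp"
    obtain a b c where eq: "z ^ 2 = mon a b c" using square_of_unit[OF z] .
    then have "even (a - i * c) \<and> even (b - j * c)" using par z by (auto simp: real_units_def)
    then obtain a' b' where "a - i * c = 2 * a'" "b - j * c = 2 * b'" by (metis dvdE)
    then have "a = 2 * a' + i * c" "b = 2 * b' + j * c" by auto
    then have "z ^ 2 = (\<epsilon>1 powi a' * \<epsilon>2 powi b' * \<theta> powi c) ^ 2" using eq sq by simp
    moreover have "\<epsilon>1 powi a' * \<epsilon>2 powi b' * \<theta> powi c > 0" using eps_pos pos by simp
    ultimately show "\<exists>a b c. \<bar>z\<bar> = \<epsilon>1 powi a * \<epsilon>2 powi b * \<theta> powi c" using power2_eq_imp_abs by blast
  next
    fix a b c assume "\<epsilon>1 powi a * \<epsilon>2 powi b * \<theta> powi c = 1"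
    then have "mon (2 * a + i * c) (2 * b + j * c) c = 1" using sq[of a b c] by simp
    from mon_independent[OF this] show "a = 0" "b = 0" "c = 0" by auto
  qed (fact unit pos)+
qed

end

lemma is_nat_square_if_rational_square:
  assumes "w \<in> \<rat>" "real_of_int z = w ^ 2"
  shows "is_nat_square z"
proof -
  have "w \<in> \<int>" using rational_Ints_if_squarefree_mult_square[of 1 w] assms(1) by (simp flip: assms(2))
  then obtain k where "w = of_int k" by (auto elim: Ints_cases)
  then have "real_of_int z = real_of_int (\<bar>k\<bar> ^ 2)" using assms(2) by simp
  then have "z = int (nat \<bar>k\<bar>) ^ 2" by (simp only: of_int_eq_iff int_nat_eq) simp
  then show ?thesis unfolding is_nat_square_def by blast
qed

section \<open>Deciding which monomials are squares\<close>

context biquad_units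
begin

text \<open>The unit has the square class of \<open>tr + 2 = 2 * x + 2\<close>. Classes 1 and
  \<open>2 * D\<close> would make it a square in \<open>k3\<close>. Class 2 means that
  \<open>x + 1\<close> is a square; class \<open>D\<close> means, through
  \<open>(x - 1) * (x + 1) = 2 * D * y ^ 2\<close>, that \<open>x - 1\<close> is one.\<close>

lemma eps3_square_iff:
  assumes xy: "\<epsilon>3 = of_int x + of_int y * r2d" and N: "N3 = 1"
  shows "(\<exists>r\<in>Kp. r ^ 2 = \<epsilon>3) \<longleftrightarrow> is_nat_square (x + 1) \<or> is_nat_square (x - 1)"
proof -
  have N': "Q3.nrm \<epsilon>3 = 1" using N by (simp add: N3_def)
  have cj: "Q3.cj \<epsilon>3 = of_int x - of_int y * r2d" unfolding xy by (rule Q3.cj_eq) simp_all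
  have tr: "U3.tr = 2 * of_int x" unfolding U3.tr_def cj unfolding xy by simp
  have x: "real_of_int x > 1" using U3.tr_gt_2[OF N'] tr by simp
  have "(of_int x + of_int y * r2d) * (of_int x - of_int y * r2d) = (1::real)"
    using N' unfolding Q3.nrm_def cj unfolding xy .
  then have disc: "(real_of_int x - 1) * (real_of_int x + 1) = 2 * real D * real_of_int y ^ 2"
    by (simp add: algebra_simps power2_eq_square)
  have y: "y \<noteq> 0" using disc x by auto
  have H: "\<epsilon>3 * (2 * of_int x + 2) = (1 + \<epsilon>3) ^ 2" using U3.eps_times_tr[OF N'] tr by simp
  show ?thesis
  proof
    assume "\<exists>r\<in>Kp. r ^ 2 = \<epsilon>3"
    then obtain r where r: "r \<in> Kp" "r ^ 2 = \<epsilon>3" by blast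
    define s where "s = (1 + \<epsilon>3) / r"
    have s: "s \<in> Kp" unfolding s_def using r eps_Kp by (simp add: Kp_intros)
    have s2: "s ^ 2 = 2 * of_int x + 2" using H r(2) eps_pos by (simp add: s_def field_simps)
    then have "s ^ 2 \<in> \<rat>" by simp
    then obtain m w where m: "m \<in> {1, 2, real D, 2 * real D}" "w \<in> \<rat>" "s ^ 2 = m * w ^ 2"
      using rational_square_in_Kp[OF s] by blast
    have e: "m * w ^ 2 = 2 * of_int x + 2" using m(3) s2 by simp
    have "w ^ 2 \<noteq> U3.tr + 2" "(w * r2d) ^ 2 \<noteq> U3.tr + 2"
      by (intro U3.tr_not_square[OF N']; use m(2) in \<open>simp add: Q3.E_intros Q3.base_in_E Q3.s_in_E\<close>)+
    then have "m \<noteq> 1" "m \<noteq> 2 * real D" using e tr by (auto simp: power_mult_distrib mult_ac)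
    then consider "m = 2" | "m = real D" using m(1) by auto
    then show "is_nat_square (x + 1) \<or> is_nat_square (x - 1)"
    proof cases
      case 1
      then have "real_of_int (x + 1) = w ^ 2" using e by simp
      then show ?thesis using is_nat_square_if_rational_square m(2) by blast
    next
      case 2
      have w: "w \<noteq> 0" using e x by auto
      have "(real_of_int x - 1) * (real D * w ^ 2) = real D * (4 * real_of_int y ^ 2)"
        using disc e 2 by (simp add: algebra_simps)
      then have "(real_of_int x - 1) * w ^ 2 = 4 * real_of_int y ^ 2" using D_pos by simp
      then have "real_of_int (x - 1) = (2 * of_int y / w) ^ 2"
        using w by (simp add: field_simps)
      then show ?thesis using is_nat_square_if_rational_square[of "2 * of_int y / w"] m(2) by simp
    qed
  next
    assume "is_nat_square (x + 1) \<or> is_nat_square (x - 1)"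
    then consider n :: nat where "x + 1 = int n ^ 2" | n :: nat where "x - 1 = int n ^ 2"
      unfolding is_nat_square_def by blast
    then show "\<exists>r\<in>Kp. r ^ 2 = \<epsilon>3"
    proof cases
      case 1
      have n: "real_of_int x + 1 = real n ^ 2" using arg_cong[OF 1, of real_of_int] by simp
      \<comment> \<open>Here \<open>r2 * n\<close> is the square root of \<open>2 * x + 2\<close>,
        by which \<open>1 + \<epsilon>3\<close> is divided.\<close>
      have "((1 + \<epsilon>3) / (r2 * real n)) ^ 2 = \<epsilon>3 * (2 * of_int x + 2) / (2 * real n ^ 2)"
        unfolding H by (simp add: power_divide power_mult_distrib)
      also have "\<dots> = \<epsilon>3" using x unfolding n[symmetric] by (simp add: field_simps)
      finally show ?thesis using eps_Kp r2_Kp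
        by (intro bexI[of _ "(1 + \<epsilon>3) / (r2 * real n)"]) (auto simp: Kp_intros subfield_of_nat[OF T.subfield_E])
    next
      case 2
      have n: "real_of_int x - 1 = real n ^ 2" using arg_cong[OF 2, of real_of_int] by simp
      have d: "(2 * of_int x + 2) * real n ^ 2 = 4 * real D * real_of_int y ^ 2"
        using disc unfolding n[symmetric] by (simp add: algebra_simps)
      \<comment> \<open>Now the square root of \<open>2 * x + 2\<close> is
        \<open>2 * rd * y / n\<close> up to sign.\<close>
      have "((1 + \<epsilon>3) * real n / (2 * rd * of_int y)) ^ 2 = \<epsilon>3 * ((2 * of_int x + 2) * real n ^ 2) / (4 * real D * real_of_int y ^ 2)"
        unfolding power_divide power_mult_distrib H[symmetric] by simp
      also have "\<dots> = \<epsilon>3" unfolding d using y D_pos by simp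
      finally show ?thesis using eps_Kp rd_Kp
        by (intro bexI[of _ "(1 + \<epsilon>3) * real n / (2 * rd * of_int y)"])
          (auto simp: Kp_intros subfield_of_nat[OF T.subfield_E] subfield_of_int[OF T.subfield_E])
    qed
  qed
qed

text \<open>Monomials with even exponents are squares, so only the exponents modulo 2
  matter.\<close>

lemma square_mon_mod2:
  assumes "r \<in> Kp" "r ^ 2 = mon a b c" "even (i - a)" "even (j - b)" "even (k - c)"
  obtains s where "s \<in> Kp" "s ^ 2 = mon i j k"
proof -
  obtain l m n where "i - a = 2 * l" "j - b = 2 * m" "k - c = 2 * n" using assms(3-5) by (metis dvdE)
  then have "i = a + 2 * l" "j = b + 2 * m" "k = c + 2 * n" by auto
  then have "(r * mon l m n) ^ 2 = mon i j k"
    by (simp add: power_mult_distrib assms(2) mon_power2 mon_mult)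
  then show ?thesis using that assms(1) mon_Kp by (meson Kp_intros(5))
qed

lemma mon_units: "mon 0 1 0 = \<epsilon>2" "mon 0 0 1 = \<epsilon>3" "mon 0 1 1 = \<epsilon>2 * \<epsilon>3" "mon 1 1 1 = \<epsilon>1 * \<epsilon>2 * \<epsilon>3"
  by (simp_all add: mon_def)

text \<open>With both norms -1 the sign conditions say that the three exponents have the same
  parity.\<close>

lemma real_basis_case_1_square:
  assumes N: "N2 = -1" "N3 = -1" and r: "r \<in> Kp" "r ^ 2 = \<epsilon>1 * \<epsilon>2 * \<epsilon>3"
  shows "real_basis (sqrt (\<epsilon>1 * \<epsilon>2 * \<epsilon>3))"
proof (rule real_basis_sqrt[where i = 1 and j = 1])
  fix s a b c assume "s \<in> Kp" "s ^ 2 = mon a b c"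
  from square_mon_signs[OF this] show "even (a - 1 * c) \<and> even (b - 1 * c)"
    using N by (auto simp: minus_one_powi split: if_splits)
qed (use r mon_units in auto)

text \<open>The exponents of a square monomial have the same parity, and the odd class is that of
  the product of all three units, which is assumed not to be a square.\<close>

lemma real_basis_case_1_nonsquare:
  assumes N: "N2 = -1" "N3 = -1" and ns: "\<nexists>r. r \<in> Kp \<and> r ^ 2 = \<epsilon>1 * \<epsilon>2 * \<epsilon>3"
  shows "real_basis \<epsilon>3"
proof (rule real_basis_eps3)
  fix s a b c assume s: "s \<in> Kp" "s ^ 2 = mon a b c"
  have p: "(even a \<longleftrightarrow> even c) \<and> (even b \<longleftrightarrow> even c)"
    using square_mon_signs[OF s] N by (auto simp: minus_one_powi split: if_splits)
  have "even c"
  proof (rule ccontr)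
    assume "odd c"
    then show False using square_mon_mod2[OF s, of 1 1 1] p ns mon_units by auto
  qed
  then show "even a \<and> even b \<and> even c" using p by simp
qed

text \<open>The signs force \<open>a\<close> and \<open>c\<close> to be even; an odd
  \<open>b\<close> would make \<open>\<epsilon>2\<close> a square.\<close>

lemma real_basis_case_2:
  assumes N: "N2 = 1" "N3 = -1"
  shows "real_basis \<epsilon>3"
proof (rule real_basis_eps3)
  fix s a b c assume s: "s \<in> Kp" "s ^ 2 = mon a b c"
  have p: "even a \<and> even c"
    using square_mon_signs[OF s] N by (auto simp: minus_one_powi split: if_splits)
  have "even b"
  proof (rule ccontr)
    assume "odd b"
    then show False using square_mon_mod2[OF s, of 0 1 0] p eps2_not_square[OF N(1)] mon_units by auto
  qed
  then show "even a \<and> even b \<and> even c" using p by simp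
qed

text \<open>Treats both values of \<open>N2\<close>. For \<open>N2 = -1\<close> the signs make
  \<open>b\<close> even. For \<open>N2 = 1\<close> an odd \<open>b\<close> would make
  \<open>\<epsilon>2\<close> or \<open>\<epsilon>2 * \<epsilon>3\<close> a square, and division by
  the square \<open>\<epsilon>3\<close> reduces the second to the first.\<close>

lemma real_basis_eps3_square:
  assumes N: "N3 = 1" and r: "r \<in> Kp" "r ^ 2 = \<epsilon>3"
  shows "real_basis (sqrt \<epsilon>3)"
proof (rule real_basis_sqrt[where i = 0 and j = 0])
  fix s a b c assume s: "s \<in> Kp" "s ^ 2 = mon a b c"
  have p: "even a \<and> (N2 = -1 \<longrightarrow> even b)"
    using square_mon_signs[OF s] N by (auto simp: minus_one_powi split: if_splits)
  have "even b"
  proof (rule ccontr)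
    assume b: "odd b"
    then have N2: "N2 = 1" using p N2_cases by blast
    show False
    proof (cases "even c")
      case True
      then show False using square_mon_mod2[OF s, of 0 1 0] p b eps2_not_square[OF N2] mon_units by auto
    next
      case False
      then obtain q where q: "q \<in> Kp" "q ^ 2 = \<epsilon>2 * \<epsilon>3"
        using square_mon_mod2[OF s, of 0 1 1] p b mon_units by auto
      have "(q / r) ^ 2 = \<epsilon>2" using q(2) r(2) eps_pos by (simp add: power_divide)
      moreover have "q / r \<in> Kp" using q(1) r(1) by (simp add: Kp_intros)
      ultimately show False using eps2_not_square[OF N2] by blast
    qed
  qed
  then show "even (a - 0 * c) \<and> even (b - 0 * c)" using p by simp
qed (use r mon_units in auto)

lemma real_basis_case_3_nonsquare:
  assumes N: "N2 = -1" "N3 = 1" and ns: "\<nexists>r. r \<in> Kp \<and> r ^ 2 = \<epsilon>3"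
  shows "real_basis \<epsilon>3"
proof (rule real_basis_eps3)
  fix s a b c assume s: "s \<in> Kp" "s ^ 2 = mon a b c"
  have p: "even a \<and> even b"
    using square_mon_signs[OF s] N by (auto simp: minus_one_powi split: if_splits)
  have "even c"
  proof (rule ccontr)
    assume "odd c"
    then show False using square_mon_mod2[OF s, of 0 0 1] p ns mon_units by auto
  qed
  then show "even a \<and> even b \<and> even c" using p by simp
qed

text \<open>The signs only give that \<open>a\<close> is even. Since neither
  \<open>\<epsilon>2\<close> nor \<open>\<epsilon>3\<close> is a square, \<open>b\<close> and
  \<open>c\<close> have the same parity, and their product does have a root.\<close>

lemma real_basis_case_4_nonsquare:
  assumes N: "N2 = 1" "N3 = 1" and ns: "\<nexists>r. r \<in> Kp \<and> r ^ 2 = \<epsilon>3"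
  shows "real_basis (sqrt (\<epsilon>2 * \<epsilon>3))"
proof -
  obtain r where r: "r \<in> Kp" "r ^ 2 = \<epsilon>2 * \<epsilon>3" using eps2_eps3_square[OF N ns] .
  show ?thesis
  proof (rule real_basis_sqrt[where i = 0 and j = 1])
    fix s a b c assume s: "s \<in> Kp" "s ^ 2 = mon a b c"
    have p: "even a"
      using square_mon_signs[OF s] N by (auto simp: minus_one_powi split: if_splits)
    have "\<not> (odd b \<and> even c)"
      using square_mon_mod2[OF s, of 0 1 0] p eps2_not_square[OF N(1)] mon_units by auto
    moreover have "\<not> (even b \<and> odd c)"
      using square_mon_mod2[OF s, of 0 0 1] p ns mon_units by auto
    ultimately show "even (a - 0 * c) \<and> even (b - 1 * c)" using p by auto
  qed (use r mon_units in auto)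
qed

text \<open>The factor \<open>z\<close> has norm 2, so the norm of an alleged square to
  \<open>k2\<close> makes 2 times a unit a square there. Up to squares this is 2 or
  \<open>2 * \<epsilon>2\<close>. The first would put \<open>r2\<close> into \<open>k2\<close>; the
  second puts \<open>tr + 2\<close> into the excluded classes 2 or \<open>2 * D\<close>.\<close>

lemma prime_above_two_not_square:
  assumes z: "z = 2 + r2 \<or> z = 2 - r2" and u: "u \<in> real_units Kp" and r: "r \<in> Kp"
  shows "r ^ 2 \<noteq> u * z"
proof
  assume eq: "r ^ 2 = u * z"
  have uK: "u \<in> Kp" "u \<noteq> 0" using u by (auto simp: real_units_def)
  have zk: "z \<in> k1" using z Q1.s_in_E by (auto simp: Q1.E_intros)
  have "Q1.cj (2 + r2) = 2 - r2" "Q1.cj (2 - r2) = 2 + r2"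
    using Q1.cj_eq[of 2 1] Q1.cj_eq[of 2 "-1"] by simp_all
  then have "Q1.nrm z = (2 + r2) * (2 - r2)" using z unfolding Q1.nrm_def by auto
  then have Nz: "Q1.nrm z = 2" by (simp add: algebra_simps)
  have "S.nrm r ^ 2 = S.nrm (u * z)" using r unfolding eq[symmetric] by (simp add: S.nrm_power Kp_S)
  also have "\<dots> = S.nrm u * 2" using uK(1) zk Nz by (simp add: S.nrm_mult Kp_S k1_Kp S_k1)
  finally have *: "S.nrm r ^ 2 = S.nrm u * 2" .
  have Su: "S.nrm u \<in> real_units k2" using S.nrm_units u by (simp add: Kp_S)
  moreover have "S.nrm u \<ge> 0" using * zero_le_power2[of "S.nrm r"] by linarith
  moreover have "S.nrm u \<noteq> 0" using Su by (simp add: real_units_def)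
  ultimately have "S.nrm u > 0" by linarith
  from U2.pos_unit[OF Su this] obtain n :: int where n: "S.nrm u = \<epsilon>2 powi n" by blast
  \<comment> \<open>Removes the square part of the unit, leaving the exponent
    \<open>n mod 2\<close>.\<close>
  define \<rho> where "\<rho> = S.nrm r * \<epsilon>2 powi (- (n div 2))"
  have rk: "\<rho> \<in> k2" unfolding \<rho>_def using S.nrm_in_F r U2.eps_in_E by (simp add: Kp_S Q2.E_intros)
  have "\<rho> ^ 2 = 2 * (\<epsilon>2 powi n * \<epsilon>2 powi (2 * - (n div 2)))"
    unfolding \<rho>_def power_mult_distrib * n power2_powi by simp
  also have "\<dots> = 2 * \<epsilon>2 powi (n mod 2)"
    using eps_pos by (simp add: power_int_add[symmetric] minus_mult_div_eq_mod)
  finally have rho: "\<rho> ^ 2 = 2 * \<epsilon>2 powi (n mod 2)" .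
  show False
  proof (cases "even n")
    case True
    then have "\<rho> ^ 2 = r2 ^ 2" using rho by simp
    then have "r2 = \<rho> \<or> r2 = - \<rho>" by (metis power2_eq_iff)
    then show False using rk S.s by (auto simp: Q2.E_intros)
  next
    case False
    then have "n mod 2 = 1" by presburger
    then have rho: "\<rho> ^ 2 = 2 * \<epsilon>2" using rho by simp
    have "Q2.nrm \<rho> ^ 2 = Q2.nrm (2 * \<epsilon>2)" using rk by (simp add: Q2.nrm_power flip: rho)
    also have "\<dots> = 4 * N2" using U2.eps_in_E by (simp add: Q2.nrm_mult Q2.E_intros Q2.nrm_base N2_def)
    finally have "N2 \<ge> 0" using zero_le_power2[of "Q2.nrm \<rho>"] by linarith
    then have N2: "N2 = 1" using N2_cases by auto
    \<comment> \<open>Chosen so that the unit cancels: by \<open>eps_times_tr\<close>,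
      \<open>w ^ 2 = 2 * (tr + 2)\<close>, which is rational.\<close>
    define w where "w = 2 * (1 + \<epsilon>2) / \<rho>"
    have w: "w \<in> k2" unfolding w_def using rk U2.eps_in_E by (simp add: Q2.E_intros)
    have "w ^ 2 = 4 * (\<epsilon>2 * (U2.tr + 2)) / (2 * \<epsilon>2)"
      unfolding w_def power_divide power_mult_distrib rho using U2.eps_times_tr N2 by (simp add: N2_def)
    then have w2: "w ^ 2 = 2 * (U2.tr + 2)" using eps_pos by simp
    then have "w ^ 2 \<in> \<rat>" using U2.tr_Ints Ints_subset_Rats by (metis Rats_add Rats_mult Rats_number_of subsetD)
    from Q2.square_in_base[OF w this] show False
    proof
      assume "w \<in> \<rat>"
      then show False using tr2_square_class[OF N2, of 2 "w / 2"] w2 by (simp add: power_divide)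
    next
      assume "\<exists>v\<in>\<rat>. w = v * rd"
      then obtain v where "v \<in> \<rat>" "w = v * rd" by blast
      then show False using tr2_square_class[OF N2, of "2 * real D" "v / 2"] w2
        by (simp add: power_divide power_mult_distrib mult.commute)
    qed
  qed
qed

end

section \<open>Totally small algebraic integers\<close>

context biquad_setting
begin

text \<open>Integrality bounds the denominators of the coordinates \<open>c\<close> and
  \<open>e\<close> at \<open>rd\<close> and \<open>r2d\<close> by 4, while the size of the
  conjugates bounds them by a multiple of the inverse of \<open>sqrt D\<close>; hence both vanish.
  What remains is an integer \<open>a + b * r2\<close> with
  \<open>a ^ 2 + 2 * b ^ 2 \<le> 4\<close>.\<close>

lemma small_algebraic_integers:
  assumes t: "t \<in> Kp" "algebraic_int t"
    and bound: "\<bar>t\<bar> \<le> 2" "\<bar>T.cj t\<bar> \<le> 2" "\<bar>S.cj t\<bar> \<le> 2" "\<bar>S.cj (T.cj t)\<bar> \<le> 2"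
  shows "t \<in> {0, 1, -1, 2, -2, r2, -r2}"
proof -
  obtain a b c e where abce: "a \<in> \<rat>" "b \<in> \<rat>" "c \<in> \<rat>" "e \<in> \<rat>" and t_eq: "t = emb a b c e"
    using t(1) unfolding mem_Kp_iff by blast
  have T: "T.cj t = emb a b (-c) (-e)" and S: "S.cj t = emb a (-b) c (-e)" and ST: "S.cj (T.cj t) = emb a (-b) (-c) e"
    using abce by (simp_all add: t_eq T_emb S_emb)
  have expand: "(2 * q * (c + e * s)) ^ 2 = 4 * (q * q) * (c ^ 2 + e ^ 2 * (s * s) + 2 * c * e * s)" for q c e s :: real
    by (simp add: power2_eq_square algebra_simps)
  \<comment> \<open>The square of the part of \<open>t\<close> negated by \<open>T\<close> lies in
    \<open>k1\<close>; \<open>y'\<close> is its conjugate, so their sum and product are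
    rational.\<close>
  define y where "y = (t - T.cj t) ^ 2"
  define y' where "y' = (S.cj t - S.cj (T.cj t)) ^ 2"
  have y: "y = 4 * real D * (c ^ 2 + 2 * e ^ 2) + 8 * real D * c * e * r2"
  proof -
    have "t - T.cj t = 2 * rd * (c + e * r2)" unfolding T unfolding t_eq emb_T by (simp add: algebra_simps)
    then have "y = 4 * (rd * rd) * (c ^ 2 + e ^ 2 * (r2 * r2) + 2 * c * e * r2)"
      unfolding y_def by (simp only: expand)
    then show ?thesis unfolding r2_r2 rd_rd by (simp add: algebra_simps)
  qed
  have y': "y' = 4 * real D * (c ^ 2 + 2 * e ^ 2) - 8 * real D * c * e * r2"
  proof -
    have "S.cj t - S.cj (T.cj t) = 2 * rd * (c - e * r2)" unfolding S ST emb_T by (simp add: algebra_simps)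
    then have "y' = 4 * (rd * rd) * (c ^ 2 + e ^ 2 * (r2 * r2) - 2 * c * e * r2)"
      unfolding y'_def using expand[of rd c "- e"] by (simp only: power2_minus) simp
    then show ?thesis unfolding r2_r2 rd_rd by (simp add: algebra_simps)
  qed
  have ai: "algebraic_int x \<Longrightarrow> algebraic_int z \<Longrightarrow> algebraic_int ((x - z) ^ 2)" for x z :: real
    using algebraic_int_add_real[of x "- z"] by (simp add: power2_eq_square algebraic_int_mult_real)
  have aT: "algebraic_int (T.cj t)" by (rule T.algebraic_int_cj[OF t(2,1)])
  have aS: "algebraic_int (S.cj t)" "algebraic_int (S.cj (T.cj t))"
    using S.algebraic_int_cj t aT T.cj_in_E by (simp_all add: Kp_S)
  have yy: "algebraic_int y" "algebraic_int y'" unfolding y_def y'_def using ai t aT aS by blast+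
  have "y + y' = 8 * real D * (c ^ 2 + 2 * e ^ 2)" using y y' by simp
  then have Z1: "8 * real D * (c ^ 2 + 2 * e ^ 2) \<in> \<int>"
    using algebraic_int_add_real[OF yy] abce
    by (intro rational_algebraic_int_is_int) simp_all
  \<comment> \<open>The product is the square of a rational number, which is then integral too and
    gives a second condition on \<open>c ^ 2\<close> and \<open>e ^ 2\<close>.\<close>
  have "y * y' = (4 * real D * (c ^ 2 + 2 * e ^ 2)) ^ 2 - (8 * real D * c * e) ^ 2 * (r2 * r2)"
    unfolding y y' by (simp add: algebra_simps power2_eq_square)
  also have "\<dots> = (4 * real D * (c ^ 2 - 2 * e ^ 2)) ^ 2" unfolding r2_r2 by (simp add: algebra_simps power2_eq_square)
  finally have "algebraic_int ((4 * real D * (c ^ 2 - 2 * e ^ 2)) ^ 2)" using algebraic_int_mult_real[OF yy] by simp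
  from algebraic_int_sqrt[OF this] have "algebraic_int (4 * real D * (c ^ 2 - 2 * e ^ 2))"
    by (simp only: real_sqrt_abs algebraic_int_abs_real)
  then have Z2: "4 * real D * (c ^ 2 - 2 * e ^ 2) \<in> \<int>"
    using abce
    by (intro rational_algebraic_int_is_int) simp_all
  \<comment> \<open>The sum isolates \<open>c\<close> and, below, the difference isolates
    \<open>e\<close>, as \<open>D\<close> or \<open>2 * D\<close> times a rational square.\<close>
  have "8 * real D * (c ^ 2 + 2 * e ^ 2) + 2 * (4 * real D * (c ^ 2 - 2 * e ^ 2)) \<in> \<int>"
    by (rule Ints_add[OF Z1 Ints_mult[OF _ Z2]]) simp
  also have "8 * real D * (c ^ 2 + 2 * e ^ 2) + 2 * (4 * real D * (c ^ 2 - 2 * e ^ 2)) = real D * (4 * c) ^ 2" by (simp add: algebra_simps power2_eq_square)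
  finally have c4: "4 * c \<in> \<int>"
    using rational_Ints_if_squarefree_mult_square[OF squarefree_D, of "4 * c"] abce by simp
  have "8 * real D * (c ^ 2 + 2 * e ^ 2) - 2 * (4 * real D * (c ^ 2 - 2 * e ^ 2)) \<in> \<int>"
    by (rule Ints_diff[OF Z1 Ints_mult[OF _ Z2]]) simp
  also have "8 * real D * (c ^ 2 + 2 * e ^ 2) - 2 * (4 * real D * (c ^ 2 - 2 * e ^ 2)) = real (2 * D) * (4 * e) ^ 2" by (simp add: algebra_simps power2_eq_square)
  finally have e4: "4 * e \<in> \<int>"
    using rational_Ints_if_squarefree_mult_square[OF squarefree_2D, of "4 * e"] abce by simp
  have sq_bound: "x ^ 2 \<le> B ^ 2" if "\<bar>x\<bar> \<le> B" for x B :: real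
    using power_mono[OF that, of 2] by simp
  have "y \<le> 4 ^ 2" "y' \<le> 4 ^ 2" unfolding y_def y'_def
    by (rule sq_bound, use bound in linarith)+
  then have B: "real D * (c ^ 2 + 2 * e ^ 2) \<le> 4" using \<open>y + y' = _\<close> by simp
  \<comment> \<open>The hypotheses give \<open>65 * (4 * x) ^ 2 \<le> 64\<close> for the integer
    \<open>4 * x\<close>.\<close>
  have small: "x = 0" if x: "4 * x \<in> \<int>" "real D * x ^ 2 \<le> 4" for x
  proof -
    obtain k where k: "4 * x = of_int k" using x(1) by (meson Ints_cases)
    have "65 * x ^ 2 \<le> real D * x ^ 2" using D_gt_64 by (intro mult_right_mono) simp_all
    then have "65 * (4 * x) ^ 2 \<le> 64" using that(2) by (simp add: power_mult_distrib)
    then have "real_of_int (65 * k ^ 2) \<le> real_of_int 64" unfolding k by simp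
    then have "65 * k ^ 2 \<le> 64" by linarith
    then have "k ^ 2 \<le> 0" by linarith
    then show ?thesis using k by simp
  qed
  have "real D * c ^ 2 \<ge> 0" "real D * e ^ 2 \<ge> 0" by simp_all
  moreover have "real D * (c ^ 2 + 2 * e ^ 2) = real D * c ^ 2 + 2 * (real D * e ^ 2)" by (simp add: algebra_simps)
  ultimately have "real D * c ^ 2 \<le> 4" "real D * e ^ 2 \<le> 4" using B by linarith+
  then have "c = 0" "e = 0" using small c4 e4 by blast+
  then have t_eq: "t = a + b * r2" and S: "S.cj t = a - b * r2" using t_eq S by (simp_all add: emb_def)
  have "t + S.cj t = 2 * a" using t_eq S by simp
  then have a2: "2 * a \<in> \<int>" using algebraic_int_add_real[OF t(2) aS(1)] abce
    by (intro rational_algebraic_int_is_int) simp_all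
  have "t * S.cj t = a ^ 2 - b ^ 2 * (r2 * r2)" unfolding S unfolding t_eq by (simp add: algebra_simps power2_eq_square)
  then have "t * S.cj t = a ^ 2 - 2 * b ^ 2" unfolding r2_r2 by simp
  then have n: "a ^ 2 - 2 * b ^ 2 \<in> \<int>" using algebraic_int_mult_real[OF t(2) aS(1)] abce
    by (intro rational_algebraic_int_is_int) simp_all
  have "(2 * a) ^ 2 - 4 * (a ^ 2 - 2 * b ^ 2) \<in> \<int>" by (rule Ints_diff[OF Ints_power[OF a2] Ints_mult[OF _ n]]) simp
  also have "(2 * a) ^ 2 - 4 * (a ^ 2 - 2 * b ^ 2) = real 2 * (2 * b) ^ 2" by simp
  finally have b2: "2 * b \<in> \<int>"
    using rational_Ints_if_squarefree_mult_square[of 2 "2 * b"] abce by (simp add: squarefree_prime)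
  obtain k A B where k: "a ^ 2 - 2 * b ^ 2 = of_int k" "2 * a = of_int A" "2 * b = of_int B"
    using n a2 b2 by (meson Ints_cases)
  have ab: "a = of_int A / 2" "b = of_int B / 2" using k by simp_all
  \<comment> \<open>So far \<open>a\<close> and \<open>b\<close> are half-integers; integrality of
    the norm forces both numerators to be even.\<close>
  have "real_of_int (A ^ 2 - 2 * B ^ 2) = of_int (4 * k)" using k(1) unfolding ab by (simp add: power_divide)
  then have AB: "A ^ 2 - 2 * B ^ 2 = 4 * k" by linarith
  then have "A ^ 2 = 2 * (B ^ 2 + 2 * k)" by simp
  then have "even (A ^ 2)" by (metis dvd_triv_left)
  then have "even A" by simp
  then obtain A' where A': "A = 2 * A'" by blast
  have "B ^ 2 = 2 * (A' ^ 2 - k)" using AB unfolding A' by (simp add: power_mult_distrib)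
  then have "even (B ^ 2)" by (metis dvd_triv_left)
  then have "even B" by simp
  then obtain B' where B': "B = 2 * B'" by blast
  have ab: "a = of_int A'" "b = of_int B'" using ab A' B' by simp_all
  have "t ^ 2 \<le> 2 ^ 2" "(S.cj t) ^ 2 \<le> 2 ^ 2" by (rule sq_bound, fact bound)+
  moreover have "t ^ 2 + (S.cj t) ^ 2 = 2 * a ^ 2 + 2 * b ^ 2 * (r2 * r2)" unfolding S unfolding t_eq by (simp add: algebra_simps power2_eq_square)
  ultimately have "a ^ 2 + 2 * b ^ 2 \<le> 4" unfolding r2_r2 by simp
  then have "real_of_int (A' ^ 2 + 2 * B' ^ 2) \<le> of_int 4" unfolding ab by simp
  then have bd: "A' ^ 2 + 2 * B' ^ 2 \<le> 4" by linarith
  have iv: "\<bar>n\<bar> \<le> m" if "n ^ 2 < (m + 1) ^ 2" "m \<ge> 0" for n m :: int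
    using power2_less_imp_less[of "\<bar>n\<bar>" "m + 1"] that by simp
  have "A' ^ 2 < 9" "B' ^ 2 < 4" using bd zero_le_power2[of A'] zero_le_power2[of B'] by linarith+
  then have "\<bar>A'\<bar> \<le> 2" "\<bar>B'\<bar> \<le> 1" using iv[of A' 2] iv[of B' 1] by simp_all
  then have "A' \<in> {-2, -1, 0, 1, 2}" "B' \<in> {-1, 0, 1}" by auto
  \<comment> \<open>The element or its conjugate would have absolute value \<open>1 + r2\<close>,
    which exceeds 2.\<close>
  moreover have "\<not> (\<bar>A'\<bar> = 1 \<and> \<bar>B'\<bar> = 1)"
  proof
    assume "\<bar>A'\<bar> = 1 \<and> \<bar>B'\<bar> = 1"
    then have "(a = 1 \<or> a = -1) \<and> (b = 1 \<or> b = -1)" using ab by auto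
    moreover have "r2 > 1" by simp
    ultimately show False using bound(1,3) unfolding S unfolding t_eq
      by (elim conjE disjE; simp only: mult_1_left mult_minus_left; linarith)
  qed
  ultimately show ?thesis unfolding t_eq ab using bd by auto
qed

end

section \<open>The imaginary field\<close>

lemma quad_field_eq: "quad_field m = complex_of_real ` adjoin \<rat> (sqrt m)"
proof -
  have "adjoin \<rat> (sqrt m) = {of_rat a + of_rat b * sqrt m | a b. True}"
    unfolding adjoin_def Rats_def by blast
  note eq = this
  show ?thesis unfolding quad_field_def eq by blast
qed

lemma quad_fund_if_fundamental_unit:
  assumes "quad_ext \<rat> (sqrt m)" "fundamental_unit m \<epsilon>"
  shows "quad_fund (sqrt m) \<epsilon>"
proof -
  have U: "units_of_field (quad_field m) = complex_of_real ` real_units (adjoin \<rat> (sqrt m))"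
    by (simp add: quad_field_eq units_of_field_real)
  show ?thesis
  proof (rule quad_fund.intro[OF assms(1)], unfold_locales)
    show "\<epsilon> \<in> real_units (adjoin \<rat> (sqrt m))" "\<epsilon> > 1"
      using assms(2) unfolding fundamental_unit_def U by auto
    fix u assume "u \<in> real_units (adjoin \<rat> (sqrt m))"
    then have "complex_of_real u \<in> units_of_field (quad_field m)" unfolding U by blast
    then obtain n :: int where "complex_of_real u = complex_of_real \<epsilon> powi n \<or> complex_of_real u = - (complex_of_real \<epsilon> powi n)"
      using assms(2) unfolding fundamental_unit_def by blast
    then have "u = \<epsilon> powi n \<or> u = - (\<epsilon> powi n)"
      by (simp only: of_real_power_int[symmetric] of_real_minus[symmetric] of_real_eq_iff)
    then show "\<exists>n::int. u = \<epsilon> powi n \<or> u = - (\<epsilon> powi n)" by blast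
  qed
qed

lemma (in quad_ext) qnorm_eq_nrm:
  assumes "F = \<rat>" "s = sqrt m" "m \<ge> 0" "z \<in> E"
  shows "qnorm m z = nrm z"
  unfolding qnorm_def
proof (rule the_equality)
  have sm: "s * s = m" using assms(2,3) by simp
  obtain u v where uv: "u \<in> F" "v \<in> F" "z = u + v * s" using assms(4) by (rule mem_EE)
  have n: "nrm z = u ^ 2 - m * v ^ 2"
  proof -
    have "nrm z = (u + v * s) * (u - v * s)" unfolding nrm_def uv(3) cj_eq[OF uv(1,2)] ..
    also have "\<dots> = u ^ 2 - (s * s) * v ^ 2" by (simp add: power2_eq_square algebra_simps)
    finally show ?thesis unfolding sm .
  qed
  obtain a b where ab: "u = of_rat a" "v = of_rat b" using uv(1,2) assms(1) by (auto elim!: Rats_cases)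
  show "\<exists>a b. z = of_rat a + of_rat b * sqrt m \<and> nrm z = (of_rat a)\<^sup>2 - m * (of_rat b)\<^sup>2"
    using uv(3) n assms(2) ab by blast
  fix k assume "\<exists>a b. z = of_rat a + of_rat b * sqrt m \<and> k = (of_rat a)\<^sup>2 - m * (of_rat b)\<^sup>2"
  then obtain c e where ce: "z = of_rat c + of_rat e * s" "k = (of_rat c)\<^sup>2 - m * (of_rat e)\<^sup>2"
    using assms(2) by blast
  then show "k = nrm z" using n uv coord_unique[of u v "of_rat c" "of_rat e"] assms(1) by simp
qed

lemma algebraic_int_root_of_unity:
  assumes "(z::complex) ^ n = 1" "n > 0" shows "algebraic_int z"
proof (rule algebraic_int_root[of 1 "monom 1 n"])
  show "\<forall>i. coeff (monom 1 n) i \<in> \<int>" by simp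
qed (use assms in \<open>simp_all add: poly_monom degree_monom_eq\<close>)

lemma is_FSU_tripleI:
  assumes U: "{x, y, z} \<subseteq> units_of_field F"
    and ex: "\<And>e. e \<in> units_of_field F \<Longrightarrow> \<exists>a b c::int. e * inverse (x powi a * y powi b * z powi c) \<in> roots_of_unity_in F"
    and uniq: "\<And>e a b c a' b' c'. e \<in> units_of_field F \<Longrightarrow>
      e * inverse (x powi a * y powi b * z powi c) \<in> roots_of_unity_in F \<Longrightarrow>
      e * inverse (x powi a' * y powi b' * z powi c') \<in> roots_of_unity_in F \<Longrightarrow> a = a' \<and> b = b' \<and> c = c'"
  shows "is_FSU F [x, y, z]"
  unfolding is_FSU_def
proof (intro conjI ballI)
  have P: "prod_list (map2 (\<lambda>u k. u powi k) [x, y, z] [a, b, c]) = x powi a * y powi b * z powi c" for a b c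
    by (simp add: mult.assoc)
  fix e assume e: "e \<in> units_of_field F"
  obtain a b c where abc: "e * inverse (x powi a * y powi b * z powi c) \<in> roots_of_unity_in F"
    using ex[OF e] by blast
  show "\<exists>!ks. length ks = length [x, y, z] \<and>
    e * inverse (prod_list (map2 (\<lambda>u k. u powi k) [x, y, z] ks)) \<in> roots_of_unity_in F"
  proof (rule ex1I[of _ "[a, b, c]"])
    fix ks :: "int list"
    assume ks: "length ks = length [x, y, z] \<and>
      e * inverse (prod_list (map2 (\<lambda>u k. u powi k) [x, y, z] ks)) \<in> roots_of_unity_in F"
    then obtain a' b' c' where k: "ks = [a', b', c']" by (auto simp: length_Suc_conv numeral_3_eq_3)
    show "ks = [a, b, c]" using ks uniq[OF e abc, of a' b' c'] unfolding k P by simp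
  qed (use abc in \<open>simp add: P del: list.map zip_Cons_Cons\<close>)
qed (use U in simp)

section \<open>Coordinates and roots of unity in the imaginary field\<close>

context biquad_setting
begin

lemma biquad_field_eq: "biquad_field (real D) = complex_of_real ` Kp"
proof -
  have "Kp = {of_rat a + of_rat b * sqrt 2 + of_rat c * sqrt (real D) + of_rat e * sqrt (2 * real D) | a b c e. True}"
    (is "_ = ?S")
  proof -
    have "z \<in> Kp \<longleftrightarrow> z \<in> ?S" for z
      unfolding mem_Kp_iff unfolding emb_def Rats_def by simp
    then show ?thesis by blast
  qed
  note eq = this
  show ?thesis unfolding biquad_field_def eq by blast
qed

text \<open>Real and imaginary parts serve as coordinates, so closure under field operations reduces
  to that of \<open>Kp\<close>.\<close>

definition KK :: "complex set" where "KK = {z. Re z \<in> Kp \<and> Im z \<in> Kp}"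

lemma K_field_eq: "K_field (real D) = KK"
proof (intro equalityI subsetI)
  fix z assume "z \<in> KK"
  then have "z = complex_of_real (Re z) + \<i> * complex_of_real (Im z)" "Re z \<in> Kp" "Im z \<in> Kp"
    by (simp_all add: KK_def flip: complex_eq)
  then show "z \<in> K_field (real D)" unfolding K_field_def biquad_field_eq by blast
qed (auto simp: K_field_def biquad_field_eq KK_def)

lemma of_real_KK_iff: "complex_of_real x \<in> KK \<longleftrightarrow> x \<in> Kp"
  by (simp add: KK_def Kp_intros)

lemma KK_mult: "z \<in> KK \<Longrightarrow> w \<in> KK \<Longrightarrow> z * w \<in> KK"
  by (simp add: KK_def Kp_intros)

lemma KK_inverse: "z \<in> KK \<Longrightarrow> inverse z \<in> KK"
  by (simp add: KK_def Kp_intros)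

lemma KK_cnj: "z \<in> KK \<Longrightarrow> cnj z \<in> KK"
  by (simp add: KK_def Kp_intros)

lemma KK_power: "z \<in> KK \<Longrightarrow> z ^ n \<in> KK"
  by (induction n) (simp_all add: KK_mult, simp add: KK_def Kp_intros)

lemma KK_ii: "\<i> \<in> KK"
  by (simp add: KK_def Kp_intros)

lemma units_KK_mult: "z \<in> units_of_field KK \<Longrightarrow> w \<in> units_of_field KK \<Longrightarrow> z * w \<in> units_of_field KK"
  unfolding units_of_field_def alg_int_iff_algebraic_int
  by (simp add: KK_mult algebraic_int_mult_complex)

lemma units_KK_inverse: "z \<in> units_of_field KK \<Longrightarrow> inverse z \<in> units_of_field KK"
  unfolding units_of_field_def by (simp add: KK_inverse)

lemma units_KK_real: "complex_of_real x \<in> units_of_field KK \<longleftrightarrow> x \<in> real_units Kp"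
  unfolding units_of_field_def real_units_def alg_int_iff_algebraic_int
  by (simp add: of_real_KK_iff flip: of_real_inverse)

lemma units_KK_root_of_unity:
  assumes "z \<in> roots_of_unity_in KK" shows "z \<in> units_of_field KK"
proof -
  obtain n :: nat where n: "z \<in> KK" "n > 0" "z ^ n = 1"
    using assms unfolding roots_of_unity_in_def by blast
  then have "z \<noteq> 0" by (auto simp: power_0_left)
  moreover have "inverse z ^ n = 1" using n by (simp add: power_inverse)
  ultimately show ?thesis using n algebraic_int_root_of_unity
    unfolding units_of_field_def alg_int_iff_algebraic_int by blast
qed

text \<open>On the unit circle \<open>w\<close> is a root of \<open>X ^ 2 - t * X + 1\<close> with
  \<open>t = 2 * Re w\<close>, so the five values of \<open>t\<close> give orders 4, 6, 3, 1 and 2.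
  Each \<open>w\<close> has an explicit root; 24 is a common multiple of the orders of these
  roots.\<close>

lemma root_of_unity_square_root:
  assumes w: "w \<in> KK" "w * cnj w = 1" and t: "2 * Re w \<in> {0, 1, -1, 2, -2}"
  obtains \<zeta> where "\<zeta> \<in> KK" "\<zeta> ^ 24 = 1" "\<zeta> ^ 2 = w"
proof -
  have q: "w ^ 2 = of_real (2 * Re w) * w - 1"
  proof -
    have "of_real (2 * Re w) = w + cnj w" by (simp add: complex_add_cnj)
    then have "of_real (2 * Re w) * w = w ^ 2 + w * cnj w" by (simp only: algebra_simps power2_eq_square)
    then show ?thesis using w(2) by simp
  qed
  consider "2 * Re w = 0" | "2 * Re w = 1" | "2 * Re w = -1" | "2 * Re w = 2" | "2 * Re w = -2"
    using t by auto
  then show ?thesis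
  proof cases
    case 1
    then have q: "w ^ 2 = -1" using q by simp
    then have "(w - \<i>) * (w + \<i>) = 0" by (simp add: algebra_simps power2_eq_square)
    then have w': "w = \<i> \<or> w = - \<i>" by (auto simp: eq_neg_iff_add_eq_0)
    \<comment> \<open>As \<open>w ^ 2 = -1\<close>, the square of \<open>1 + w\<close> is
      \<open>2 * w\<close>; the field contains this eighth root of unity because it contains
      \<open>r2\<close>.\<close>
    define \<zeta> where "\<zeta> = (1 + w) / complex_of_real r2"
    have "complex_of_real r2 ^ 2 = 2" by (simp flip: of_real_power)
    then have z2: "\<zeta> ^ 2 = w" using q by (simp add: \<zeta>_def power_divide power2_sum)
    have "\<zeta> ^ 24 = ((\<zeta> ^ 2) ^ 2) ^ 6" by (simp flip: power_mult)
    also have "\<dots> = 1" unfolding z2 q by simp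
    finally have "\<zeta> ^ 24 = 1" .
    moreover have "\<zeta> \<in> KK" unfolding \<zeta>_def using w(1) r2_Kp by (simp add: KK_def Kp_intros)
    ultimately show ?thesis using z2 that by blast
  next
    case 2
    then have q: "w ^ 2 = w - 1" using q by simp
    have "w ^ 3 = w * w ^ 2" by (simp add: power3_eq_cube power2_eq_square)
    also have "\<dots> = w ^ 2 - w" by (subst q) (simp add: algebra_simps power2_eq_square)
    finally have w3: "w ^ 3 = -1" using q by simp
    have "(\<i> * w ^ 2) ^ 24 = (w ^ 3) ^ 16" by (simp add: power_mult_distrib flip: power_mult)
    moreover have "(w ^ 2) ^ 2 = w * w ^ 3" by (simp add: power2_eq_square power3_eq_cube)
    then have "(\<i> * w ^ 2) ^ 2 = - w * w ^ 3" by (simp add: power_mult_distrib)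
    ultimately show ?thesis using that[of "\<i> * w ^ 2"] w(1) w3 by (simp add: KK_mult KK_power KK_ii)
  next
    case 3
    then have q: "w ^ 2 = - w - 1" using q by simp
    have "w ^ 3 = w * w ^ 2" by (simp add: power3_eq_cube power2_eq_square)
    also have "\<dots> = - (w ^ 2) - w" by (subst q) (simp add: algebra_simps power2_eq_square)
    finally have w3: "w ^ 3 = 1" using q by simp
    have "(w ^ 2) ^ 24 = (w ^ 3) ^ 16" by (simp flip: power_mult)
    moreover have "(w ^ 2) ^ 2 = w * w ^ 3" by (simp add: power2_eq_square power3_eq_cube)
    ultimately show ?thesis using that[of "w ^ 2"] w(1) w3 by (simp add: KK_power)
  next
    case 4
    then have "(w - 1) ^ 2 = 0" using q by (simp add: power2_eq_square algebra_simps)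
    then have "w = 1" by simp
    then show ?thesis using that[of 1] w(1) by simp
  next
    case 5
    then have q: "w ^ 2 = - 2 * w - 1" using q by simp
    have "(w + 1) ^ 2 = w ^ 2 + 2 * w + 1" by (simp add: power2_eq_square algebra_simps)
    then have "(w + 1) ^ 2 = 0" unfolding q by simp
    then have "w = -1" by (simp add: eq_neg_iff_add_eq_0)
    moreover have "\<i> ^ 24 = (\<i> ^ 2) ^ 12" by (simp only: power_mult[symmetric]) simp
    ultimately show ?thesis using that[of \<i>] by (simp add: KK_ii)
  qed
qed

end

section \<open>Unit index and fundamental systems of both fields\<close>

context biquad_units
begin

text \<open>The quotient has absolute value 1, and so do its images when the conjugations of
  \<open>Kp\<close> act on both coordinates. Its trace is therefore a totally small integer, and
  only the values \<plusminus>\<open>r2\<close> need a separate argument.\<close>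

lemma unit_quotient_trace:
  assumes z: "z \<in> units_of_field KK"
  shows "2 * Re (z / cnj z) \<in> {0, 1, -1, 2, -2}"
proof -
  define w where "w = z / cnj z"
  have zK: "z \<in> KK" "z \<noteq> 0" "algebraic_int z" "algebraic_int (inverse z)"
    using z by (auto simp: units_of_field_def alg_int_iff_algebraic_int)
  define u where "u = Re z"
  define v where "v = Im z"
  define n where "n = u ^ 2 + v ^ 2"
  have uv: "u \<in> Kp" "v \<in> Kp" using zK(1) by (auto simp: KK_def u_def v_def)
  have n_pos: "n > 0" using zK(2) by (simp add: n_def u_def v_def complex_neq_0)
  have zz: "z * cnj z = complex_of_real n" by (simp add: n_def u_def v_def complex_mult_cnj)
  have "complex_of_real n \<in> units_of_field KK"
    unfolding zz[symmetric] using zK KK_cnj algebraic_int_cnj[of "inverse z"]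
    by (intro units_KK_mult z) (simp add: units_of_field_def alg_int_iff_algebraic_int)
  then have n_unit: "n \<in> real_units Kp" by (simp add: units_KK_real)
  have "w = z * z / (z * cnj z)" using zK(2) by (simp add: w_def)
  then have w: "w = z * z / complex_of_real n" by (simp only: zz)
  have re: "Re w = (u ^ 2 - v ^ 2) / n" and im: "Im w = 2 * u * v / n"
    by (simp_all add: w u_def v_def power2_eq_square)
  have K: "Re w \<in> Kp" "Im w \<in> Kp" unfolding re im n_def using uv by (simp_all add: Kp_intros)
  have "(u ^ 2 - v ^ 2) ^ 2 + (2 * u * v) ^ 2 = n ^ 2" unfolding n_def by (simp add: power2_eq_square algebra_simps)
  then have unit: "(Re w) ^ 2 + (Im w) ^ 2 = 1"
    unfolding re im power_divide add_divide_distrib[symmetric] using n_pos by simp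
  have bound: "\<bar>2 * x\<bar> \<le> 2" if "x ^ 2 + y ^ 2 = 1" for x y :: real
  proof -
    have "x ^ 2 \<le> 1" using that zero_le_power2[of y] by linarith
    then have "\<bar>x\<bar> \<le> 1" by (simp add: abs_square_le_1)
    then show ?thesis by simp
  qed
  \<comment> \<open>Conjugations applied to real and imaginary parts preserve the equation of the
    unit circle, so no automorphisms of the imaginary field have to be built.\<close>
  have T: "(T.cj x) ^ 2 + (T.cj y) ^ 2 = 1" if "x \<in> Kp" "y \<in> Kp" "x ^ 2 + y ^ 2 = 1" for x y
  proof -
    have "T.cj (x ^ 2 + y ^ 2) = T.cj x ^ 2 + T.cj y ^ 2"
      using that(1,2) by (simp add: T.cj_add T.cj_power Kp_intros)
    then show ?thesis unfolding that(3) using T.cj_base[OF Q1.E_intros(2)] by simp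
  qed
  have S: "(S.cj x) ^ 2 + (S.cj y) ^ 2 = 1" if "x \<in> Kp" "y \<in> Kp" "x ^ 2 + y ^ 2 = 1" for x y
  proof -
    have "S.cj (x ^ 2 + y ^ 2) = S.cj x ^ 2 + S.cj y ^ 2"
      using that(1,2) by (simp add: S.cj_add S.cj_power Kp_intros Kp_S)
    then show ?thesis unfolding that(3) using S.cj_base[OF Q2.E_intros(2)] by simp
  qed
  have two: "T.cj (2 * x) = 2 * T.cj x" "S.cj (2 * x) = 2 * S.cj x" if "x \<in> Kp" for x
    using that by (simp_all add: T.cj_mult S.cj_mult T.cj_base S.cj_base Q1.E_intros Q2.E_intros Kp_intros Kp_S)
  have cjK: "T.cj x \<in> Kp" if "x \<in> Kp" for x using that by (rule T.cj_in_E)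
  have "algebraic_int w" unfolding w_def divide_inverse
    using zK(3,4) algebraic_int_cnj[of "inverse z"] by (intro algebraic_int_mult_complex) simp_all
  then have "algebraic_int (w + cnj w)" by (intro algebraic_int_add_complex) auto
  then have ai: "algebraic_int (2 * Re w)" by (simp only: complex_add_cnj algebraic_int_of_real_iff)
  have "2 * Re w \<in> {0, 1, -1, 2, -2, r2, -r2}"
  proof (rule small_algebraic_integers)
    show "2 * Re w \<in> Kp" using K by (simp add: Kp_intros)
    show "\<bar>2 * Re w\<bar> \<le> 2" by (rule bound[OF unit])
    have uT: "(T.cj (Re w)) ^ 2 + (T.cj (Im w)) ^ 2 = 1" by (rule T[OF K unit])
    then show "\<bar>T.cj (2 * Re w)\<bar> \<le> 2" unfolding two(1)[OF K(1)] by (rule bound)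
    show "\<bar>S.cj (2 * Re w)\<bar> \<le> 2" unfolding two(2)[OF K(1)] by (rule bound[OF S[OF K unit]])
    show "\<bar>S.cj (T.cj (2 * Re w))\<bar> \<le> 2" unfolding two(1)[OF K(1)] two(2)[OF cjK[OF K(1)]]
      by (rule bound[OF S[OF cjK[OF K(1)] cjK[OF K(2)] uT]])
  qed (fact ai)
  moreover have "2 * Re w \<noteq> r2 \<and> 2 * Re w \<noteq> - r2"
  proof -
    \<comment> \<open>With \<open>2 * u = z + cnj z\<close> and \<open>n = z * cnj z\<close> this
      reads \<open>(z + cnj z) ^ 2 = n * (2 + w + cnj w)\<close>. The trace
      \<plusminus>\<open>r2\<close> would make a unit times \<open>2 + r2\<close> or
      \<open>2 - r2\<close> a square.\<close>
    have "(2 * u) ^ 2 = n * (2 + 2 * Re w)"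
    proof -
      have "n * (2 + 2 * Re w) = 2 * n + 2 * (u ^ 2 - v ^ 2)"
        unfolding re using n_pos by (simp add: field_simps)
      then show ?thesis by (simp add: n_def power_mult_distrib)
    qed
    moreover have "2 * u \<in> Kp" using uv by (simp add: Kp_intros)
    ultimately show ?thesis using prime_above_two_not_square[OF _ n_unit, of "2 + 2 * Re w" "2 * u"] by auto
  qed
  ultimately show ?thesis unfolding w_def by auto
qed

text \<open>If \<open>\<zeta> ^ 2 = z / cnj z\<close> and \<open>\<zeta>\<close> lies on the unit
  circle, then \<open>z / \<zeta>\<close> equals its own complex conjugate.\<close>

lemma unit_decomposition:
  assumes z: "z \<in> units_of_field KK"
  obtains \<zeta> x where "\<zeta> \<in> KK" "\<zeta> ^ 24 = 1" "x \<in> real_units Kp" "z = \<zeta> * complex_of_real x"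
proof -
  have zK: "z \<in> KK" "z \<noteq> 0" using z by (auto simp: units_of_field_def)
  have wK: "z / cnj z \<in> KK" unfolding divide_inverse using zK(1) by (intro KK_mult KK_inverse KK_cnj)
  obtain \<zeta> where \<zeta>: "\<zeta> \<in> KK" "\<zeta> ^ 24 = 1" "\<zeta> ^ 2 = z / cnj z"
    using root_of_unity_square_root[OF wK _ unit_quotient_trace[OF z]] zK(2) by auto
  have \<zeta>0: "\<zeta> \<noteq> 0" using \<zeta>(2) by auto
  have "norm \<zeta> ^ 24 = 1 ^ 24" using \<zeta>(2) by (simp flip: norm_power)
  then have "norm \<zeta> = 1" by (rule power_eq_imp_eq_base) simp_all
  then have c: "cnj \<zeta> = inverse \<zeta>"
    using \<zeta>0 complex_norm_square[of \<zeta>] by (simp add: inverse_unique)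
  have "z = \<zeta> ^ 2 * cnj z" using \<zeta>(3) zK(2) by simp
  then have "z / \<zeta> = (\<zeta> ^ 2 * cnj z) / \<zeta>" by (rule arg_cong)
  also have "\<dots> = \<zeta> * cnj z" using \<zeta>0 by (simp add: power2_eq_square)
  also have "\<dots> = cnj (z / \<zeta>)" by (simp add: c divide_inverse)
  finally have "cnj (z / \<zeta>) = z / \<zeta>" by (rule sym)
  then obtain x where x: "z / \<zeta> = complex_of_real x" by (metis Reals_cnj_iff Reals_cases)
  have "\<zeta> \<in> units_of_field KK"
    using \<zeta> by (intro units_KK_root_of_unity) (auto simp: roots_of_unity_in_def intro!: exI[of _ 24])
  then have "z / \<zeta> \<in> units_of_field KK" unfolding divide_inverse by (intro units_KK_mult units_KK_inverse z)
  then have "x \<in> real_units Kp" unfolding x by (simp add: units_KK_real)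
  moreover have "z = \<zeta> * complex_of_real x" using x \<zeta>0 by (simp add: field_simps)
  ultimately show ?thesis using that \<zeta> by blast
qed

text \<open>By \<open>unit_decomposition\<close> the subgroup \<open>H\<close> is the whole unit
  group, so there is just one coset.\<close>

lemma hasse_unit_index_1: "hasse_unit_index KK (complex_of_real ` Kp) = 1"
proof -
  define H where "H = {w * u | w u. w \<in> roots_of_unity_in KK \<and> u \<in> units_of_field (complex_of_real ` Kp)}"
  have H: "H = units_of_field KK"
  proof (intro equalityI subsetI)
    fix h assume "h \<in> H"
    then obtain w x where "w \<in> roots_of_unity_in KK" "x \<in> real_units Kp" "h = w * complex_of_real x"
      unfolding H_def units_of_field_real by blast
    then show "h \<in> units_of_field KK"
      using units_KK_mult[OF units_KK_root_of_unity] units_KK_real by simp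
  next
    fix h assume "h \<in> units_of_field KK"
    then obtain \<zeta> x where \<zeta>: "\<zeta> \<in> KK" "\<zeta> ^ 24 = 1" "x \<in> real_units Kp" "h = \<zeta> * complex_of_real x"
      by (rule unit_decomposition)
    then have "\<zeta> \<in> roots_of_unity_in KK" by (auto simp: roots_of_unity_in_def intro!: exI[of _ 24])
    then show "h \<in> H" unfolding H_def units_of_field_real using \<zeta> by blast
  qed
  have coset: "(\<lambda>h. x * h) ` H = H" if x: "x \<in> units_of_field KK" for x
  proof (intro equalityI subsetI)
    fix h assume h: "h \<in> H"
    have "inverse x * h \<in> H" using h x unfolding H by (intro units_KK_mult units_KK_inverse)
    moreover have "h = x * (inverse x * h)" using x by (simp add: units_of_field_def)
    ultimately show "h \<in> (\<lambda>h. x * h) ` H" by blast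
  qed (use x in \<open>auto simp: H units_KK_mult\<close>)
  have "1 \<in> units_of_field KK" using units_KK_real[of 1] real_units_1[OF T.subfield_E] by simp
  then have "(\<lambda>x. (\<lambda>h. x * h) ` H) ` units_of_field KK = {H}" using coset by force
  then show ?thesis unfolding hasse_unit_index_def Let_def H_def[symmetric] by simp
qed

text \<open>Stated for a general \<open>F\<close> to serve both fields. The sign left over by a real
  basis is absorbed into the root of unity; this is what \<open>neg\<close> is for.\<close>

lemma is_FSU_if_real_basis:
  assumes \<theta>: "real_basis \<theta>"
    and real: "complex_of_real ` real_units Kp \<subseteq> units_of_field F"
    and dec: "\<And>e. e \<in> units_of_field F \<Longrightarrow> \<exists>\<zeta>\<in>roots_of_unity_in F. \<exists>x\<in>real_units Kp. e = \<zeta> * complex_of_real x"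
    and neg: "\<And>\<zeta>. \<zeta> \<in> roots_of_unity_in F \<Longrightarrow> - \<zeta> \<in> roots_of_unity_in F"
  shows "is_FSU F [complex_of_real \<epsilon>1, complex_of_real \<epsilon>2, complex_of_real \<theta>]"
proof -
  define M where "M a b c = \<epsilon>1 powi a * \<epsilon>2 powi b * \<theta> powi c" for a b c :: int
  have M: "complex_of_real \<epsilon>1 powi a * complex_of_real \<epsilon>2 powi b * complex_of_real \<theta> powi c = complex_of_real (M a b c)" for a b c
    by (simp add: M_def)
  have M_gen: "\<exists>a b c. \<bar>z\<bar> = M a b c" if "z \<in> real_units Kp" for z
    using \<theta> that by (simp add: real_basis_def M_def)
  have M_ind: "a = 0 \<and> b = 0 \<and> c = 0" if "M a b c = 1" for a b c
    using \<theta> that by (simp add: real_basis_def M_def)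
  have th_pos: "\<theta> > 0" using \<theta> by (simp add: real_basis_def)
  have M_pos: "M a b c > 0" for a b c using th_pos eps_pos by (simp add: M_def)
  have M_div: "M a b c / M a' b' c' = M (a - a') (b - b') (c - c')" for a b c a' b' c'
    using th_pos eps_pos by (simp add: M_def power_int_diff)
  show ?thesis
  proof (rule is_FSU_tripleI, unfold M)
    show "{complex_of_real \<epsilon>1, complex_of_real \<epsilon>2, complex_of_real \<theta>} \<subseteq> units_of_field F"
      using real eps_units \<theta> by (auto simp: real_basis_def)
  next
    fix e assume "e \<in> units_of_field F"
    then obtain \<zeta> x where x: "\<zeta> \<in> roots_of_unity_in F" "x \<in> real_units Kp" "e = \<zeta> * complex_of_real x"
      using dec by blast
    then obtain a b c where abc: "\<bar>x\<bar> = M a b c" using M_gen by blast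
    define q where "q = x / M a b c"
    have "e * inverse (complex_of_real (M a b c)) = \<zeta> * complex_of_real q"
      by (simp add: q_def x(3) divide_inverse)
    moreover have "q = 1 \<or> q = -1"
      using abc M_pos[of a b c] by (auto simp: q_def abs_if field_simps split: if_splits)
    ultimately have "e * inverse (complex_of_real (M a b c)) \<in> roots_of_unity_in F" using x(1) neg by auto
    then show "\<exists>a b c. e * inverse (complex_of_real (M a b c)) \<in> roots_of_unity_in F" by blast
  next
    fix e a b c a' b' c'
    assume e: "e \<in> units_of_field F" "e * inverse (complex_of_real (M a b c)) \<in> roots_of_unity_in F"
      "e * inverse (complex_of_real (M a' b' c')) \<in> roots_of_unity_in F"
    \<comment> \<open>Roots of unity have absolute value 1, so the absolute value of
      \<open>e\<close> determines the monomial and hence the exponents.\<close>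
    have "norm e = M i j k" if root: "e * inverse (complex_of_real (M i j k)) \<in> roots_of_unity_in F" for i j k
    proof -
      obtain n :: nat where n: "n > 0" "(e * inverse (complex_of_real (M i j k))) ^ n = 1"
        using root unfolding roots_of_unity_in_def by blast
      then have "norm (e * inverse (complex_of_real (M i j k))) ^ n = 1 ^ n" by (simp flip: norm_power)
      then have "norm (e * inverse (complex_of_real (M i j k))) = 1"
        using n(1) by (intro power_eq_imp_eq_base[of _ n 1]) simp_all
      then show ?thesis using M_pos[of i j k] by (simp add: norm_divide field_simps flip: divide_inverse)
    qed
    from this[OF e(2)] this[OF e(3)] have "M a b c / M a' b' c' = 1" using M_pos[of a' b' c'] by simp
    then have "M (a - a') (b - b') (c - c') = 1" by (simp only: M_div)
    then show "a = a' \<and> b = b' \<and> c = c'" using M_ind by fastforce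
  qed
qed

text \<open>For the real field the decomposition is trivial with root of unity 1; for the imaginary
  field it is \<open>unit_decomposition\<close>.\<close>

lemma is_FSU_both:
  assumes "real_basis \<theta>"
  shows "is_FSU (complex_of_real ` Kp) [complex_of_real \<epsilon>1, complex_of_real \<epsilon>2, complex_of_real \<theta>] \<and>
    is_FSU KK [complex_of_real \<epsilon>1, complex_of_real \<epsilon>2, complex_of_real \<theta>]"
proof
  have neg: "- \<zeta> \<in> roots_of_unity_in F"
    if root: "\<zeta> \<in> roots_of_unity_in F" and F: "\<And>z. z \<in> F \<Longrightarrow> - z \<in> F" for \<zeta> F
  proof -
    obtain n :: nat where n: "n > 0" "\<zeta> ^ n = 1" "\<zeta> \<in> F" using root by (auto simp: roots_of_unity_in_def)
    have "(- \<zeta>) ^ (2 * n) = (\<zeta> ^ n) ^ 2" by (simp add: power_mult mult.commute flip: power_mult)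
    then have "(- \<zeta>) ^ (2 * n) = 1" using n by simp
    moreover have "2 * n > 0" using n by simp
    ultimately show ?thesis using n(3) F unfolding roots_of_unity_in_def by blast
  qed
  show "is_FSU (complex_of_real ` Kp) [complex_of_real \<epsilon>1, complex_of_real \<epsilon>2, complex_of_real \<theta>]"
  proof (rule is_FSU_if_real_basis[OF assms])
    have "1 \<in> complex_of_real ` Kp" using Kp_intros(2) by (metis image_eqI of_real_1)
    then have one: "1 \<in> roots_of_unity_in (complex_of_real ` Kp)"
      by (auto simp: roots_of_unity_in_def)
    show "\<exists>\<zeta>\<in>roots_of_unity_in (complex_of_real ` Kp). \<exists>x\<in>real_units Kp. e = \<zeta> * complex_of_real x"
      if "e \<in> units_of_field (complex_of_real ` Kp)" for e
      using that one unfolding units_of_field_real by (intro bexI[OF _ one]) auto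
    show "- \<zeta> \<in> roots_of_unity_in (complex_of_real ` Kp)" if "\<zeta> \<in> roots_of_unity_in (complex_of_real ` Kp)" for \<zeta>
      by (rule neg[OF that]) (auto simp: Kp_intros simp flip: of_real_minus)
  qed (simp add: units_of_field_real)
  show "is_FSU KK [complex_of_real \<epsilon>1, complex_of_real \<epsilon>2, complex_of_real \<theta>]"
  proof (rule is_FSU_if_real_basis[OF assms])
    show "\<exists>\<zeta>\<in>roots_of_unity_in KK. \<exists>x\<in>real_units Kp. e = \<zeta> * complex_of_real x"
      if e: "e \<in> units_of_field KK" for e
    proof -
      obtain \<zeta> x where "\<zeta> \<in> KK" "\<zeta> ^ 24 = 1" "x \<in> real_units Kp" "e = \<zeta> * complex_of_real x"
        using e by (rule unit_decomposition)
      moreover from this have "\<zeta> \<in> roots_of_unity_in KK" by (auto simp: roots_of_unity_in_def intro!: exI[of _ 24])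
      ultimately show ?thesis by blast
    qed
    show "- \<zeta> \<in> roots_of_unity_in KK" if "\<zeta> \<in> roots_of_unity_in KK" for \<zeta>
      by (rule neg[OF that]) (simp add: KK_def Kp_intros)
  qed (auto simp: units_KK_real)
qed

end

theorem theorem2:
  fixes p1 p2 :: nat and \<epsilon>1 \<epsilon>2 \<epsilon>3 :: real and x y :: int
  assumes "prime p1" and "prime p2" and "p1 \<noteq> p2"
    and "p1 mod 4 = 1" and "p2 mod 4 = 1"
    and "fundamental_unit 2 \<epsilon>1"
    and "fundamental_unit (real (p1 * p2)) \<epsilon>2"
    and "fundamental_unit (real (2 * p1 * p2)) \<epsilon>3"
    and "\<epsilon>3 = of_int x + of_int y * sqrt (real (2 * p1 * p2))"
  defines "Kp \<equiv> biquad_field (real (p1 * p2))"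
    and "K \<equiv> K_field (real (p1 * p2))"
    and "N2 \<equiv> qnorm (real (p1 * p2)) \<epsilon>2"
    and "N3 \<equiv> qnorm (real (2 * p1 * p2)) \<epsilon>3"
    and "e1 \<equiv> complex_of_real \<epsilon>1"
    and "e2 \<equiv> complex_of_real \<epsilon>2"
    and "e3 \<equiv> complex_of_real \<epsilon>3"
  shows "hasse_unit_index K Kp = 1 \<and>
    ((N2 = -1 \<and> N3 = -1) \<longrightarrow>
       (((\<exists>s. s \<in> Kp \<and> s ^ 2 = e1 * e2 * e3) \<longrightarrow>
          is_FSU Kp [e1, e2, complex_of_real (sqrt (\<epsilon>1 * \<epsilon>2 * \<epsilon>3))] \<and>
          is_FSU K [e1, e2, complex_of_real (sqrt (\<epsilon>1 * \<epsilon>2 * \<epsilon>3))]) \<and>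
        ((\<nexists>s. s \<in> Kp \<and> s ^ 2 = e1 * e2 * e3) \<longrightarrow>
          is_FSU Kp [e1, e2, e3] \<and> is_FSU K [e1, e2, e3]))) \<and>
    ((N2 = 1 \<and> N3 = -1) \<longrightarrow> is_FSU Kp [e1, e2, e3] \<and> is_FSU K [e1, e2, e3]) \<and>
    ((N3 = 1 \<and> N2 = -1) \<longrightarrow>
       ((is_nat_square (x + 1) \<or> is_nat_square (x - 1)) \<longrightarrow>
          is_FSU Kp [e1, e2, complex_of_real (sqrt \<epsilon>3)] \<and>
          is_FSU K [e1, e2, complex_of_real (sqrt \<epsilon>3)]) \<and>
       (\<not> (is_nat_square (x + 1) \<or> is_nat_square (x - 1)) \<longrightarrow>
          is_FSU Kp [e1, e2, e3] \<and> is_FSU K [e1, e2, e3])) \<and>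
    ((N2 = 1 \<and> N3 = 1) \<longrightarrow>
       ((is_nat_square (x + 1) \<or> is_nat_square (x - 1)) \<longrightarrow>
          is_FSU Kp [e1, e2, complex_of_real (sqrt \<epsilon>3)] \<and>
          is_FSU K [e1, e2, complex_of_real (sqrt \<epsilon>3)]) \<and>
       (\<not> (is_nat_square (x + 1) \<or> is_nat_square (x - 1)) \<longrightarrow>
          is_FSU Kp [e1, e2, complex_of_real (sqrt (\<epsilon>2 * \<epsilon>3))] \<and>
          is_FSU K [e1, e2, complex_of_real (sqrt (\<epsilon>2 * \<epsilon>3))]))"
proof -
  interpret S: biquad_setting p1 p2 by unfold_locales (fact assms(1-5))+
  have D: "real (p1 * p2) = real S.D" "real (2 * p1 * p2) = 2 * real S.D"
    by (simp_all add: S.D_def)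
  have "quad_fund (sqrt 2) \<epsilon>1" "quad_fund (sqrt (real S.D)) \<epsilon>2" "quad_fund (sqrt (2 * real S.D)) \<epsilon>3"
    using quad_fund_if_fundamental_unit[OF S.Q1.quad_ext_axioms assms(6)]
      quad_fund_if_fundamental_unit[OF S.Q2.quad_ext_axioms assms(7)[unfolded D]]
      quad_fund_if_fundamental_unit[OF S.Q3.quad_ext_axioms assms(8)[unfolded D]] .
  then interpret B: biquad_units p1 p2 \<epsilon>1 \<epsilon>2 \<epsilon>3
    by (intro biquad_units.intro S.biquad_setting_axioms biquad_units_axioms.intro)
  let ?R = "adjoin (adjoin \<rat> (sqrt 2)) (sqrt (real S.D))"
  have Kp: "Kp = complex_of_real ` ?R" unfolding Kp_def D by (rule S.biquad_field_eq)
  have K: "K = S.KK" unfolding K_def D by (rule S.K_field_eq)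
  have N2: "N2 = B.N2" unfolding N2_def D B.N2_def
    using B.U2.eps_in_E by (intro S.Q2.qnorm_eq_nrm) simp_all
  have N3: "N3 = B.N3" unfolding N3_def D B.N3_def
    using B.U3.eps_in_E by (intro S.Q3.qnorm_eq_nrm) simp_all
  have fsu: "is_FSU Kp [e1, e2, complex_of_real \<theta>] \<and> is_FSU K [e1, e2, complex_of_real \<theta>]" if "B.real_basis \<theta>" for \<theta>
    unfolding Kp K e1_def e2_def by (rule B.is_FSU_both[OF that])
  have sq123: "(\<exists>s. s \<in> Kp \<and> s ^ 2 = e1 * e2 * e3) \<longleftrightarrow> (\<exists>r. r \<in> ?R \<and> r ^ 2 = \<epsilon>1 * \<epsilon>2 * \<epsilon>3)"
  proof -
    have "complex_of_real r ^ 2 = e1 * e2 * e3 \<longleftrightarrow> r ^ 2 = \<epsilon>1 * \<epsilon>2 * \<epsilon>3" for r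
      unfolding e1_def e2_def e3_def by (simp only: of_real_power[symmetric] of_real_mult[symmetric] of_real_eq_iff)
    then show ?thesis unfolding Kp by blast
  qed
  have sq3: "(\<exists>r. r \<in> ?R \<and> r ^ 2 = \<epsilon>3) \<longleftrightarrow> is_nat_square (x + 1) \<or> is_nat_square (x - 1)" if "N3 = 1"
    using B.eps3_square_iff[of x y] assms(9) that unfolding D N3 by blast
  have hasse: "hasse_unit_index K Kp = 1" unfolding K Kp by (rule B.hasse_unit_index_1)
  have c1: "is_FSU Kp [e1, e2, complex_of_real (sqrt (\<epsilon>1 * \<epsilon>2 * \<epsilon>3))] \<and>
      is_FSU K [e1, e2, complex_of_real (sqrt (\<epsilon>1 * \<epsilon>2 * \<epsilon>3))]"
    if "N2 = -1" "N3 = -1" "\<exists>s. s \<in> Kp \<and> s ^ 2 = e1 * e2 * e3"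
    using that fsu[OF B.real_basis_case_1_square] unfolding sq123 N2 N3 by blast
  have c1': "is_FSU Kp [e1, e2, e3] \<and> is_FSU K [e1, e2, e3]"
    if "N2 = -1" "N3 = -1" "\<nexists>s. s \<in> Kp \<and> s ^ 2 = e1 * e2 * e3"
    using that fsu[OF B.real_basis_case_1_nonsquare] unfolding sq123 N2 N3 unfolding e3_def by blast
  have c2: "is_FSU Kp [e1, e2, e3] \<and> is_FSU K [e1, e2, e3]" if "N2 = 1" "N3 = -1"
    using that fsu[OF B.real_basis_case_2] unfolding N2 N3 e3_def by blast
  \<comment> \<open>Independent of \<open>N2\<close>, so this serves case (3)(i) as well as case
    (4)(i).\<close>
  have c3: "is_FSU Kp [e1, e2, complex_of_real (sqrt \<epsilon>3)] \<and> is_FSU K [e1, e2, complex_of_real (sqrt \<epsilon>3)]"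
    if "N3 = 1" "is_nat_square (x + 1) \<or> is_nat_square (x - 1)"
    using that sq3 fsu[OF B.real_basis_eps3_square] unfolding N3 by blast
  have c3': "is_FSU Kp [e1, e2, e3] \<and> is_FSU K [e1, e2, e3]"
    if "N2 = -1" "N3 = 1" "\<not> (is_nat_square (x + 1) \<or> is_nat_square (x - 1))"
    using that sq3 fsu[OF B.real_basis_case_3_nonsquare] unfolding N2 N3 e3_def by blast
  have c4: "is_FSU Kp [e1, e2, complex_of_real (sqrt (\<epsilon>2 * \<epsilon>3))] \<and>
      is_FSU K [e1, e2, complex_of_real (sqrt (\<epsilon>2 * \<epsilon>3))]"
    if "N2 = 1" "N3 = 1" "\<not> (is_nat_square (x + 1) \<or> is_nat_square (x - 1))"
    using that sq3 fsu[OF B.real_basis_case_4_nonsquare] unfolding N2 N3 by blast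
  note cases = c1 c1' c2 c3 c3' c4
  show ?thesis
    by (intro conjI impI; (elim conjE)?;
        (rule hasse | (rule cases[THEN conjunct1] cases[THEN conjunct2]; assumption)))
qed

end
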